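(* Given a $d$-uniform hypergraph $G=(V,E)$ with $n$ vertices, the algorithm Iterated-Sampling (defined in the context) computes a maximal matching in $G$ with high probability in $O(\log n)$ MPC rounds on machines of memory $s=\Theta(d\cdot n)$.
   Context: A hypergraph is $d$-uniform if every hyperedge is a set of exactly $d$ vertices. A matching is a set of pairwise disjoint hyperedges; it is maximal if it is not properly contained in another matching. For $I\subseteq V$, $G[I]$ is the subhypergraph induced by $I$, and $E[I]$ is its edge set, i.e. the hyperedges all of whose vertices lie in $I$. MPC (Massively Parallel Computation) model: an input of size $N$ is distributed over $k$ machines, each with space $s$, where $k\cdot s=\tilde O(N)$ ($\tilde O$ hides polylogarithmic factors). Computation proceeds in synchronous rounds. In each round every machine performs arbitrary local computation on its data (of size at most $s$; there is no restriction on computational power) and then sends messages to other machines; the total communication sent or received by a machine in a round is at most $s$. The received messages are its input for the next round. Algorithm Iterated-Sampling (with memory parameter $s$): 1. Set $M:=\emptyset$ and $\mathcal S:=E$. 2. Sample every edge $e\in\mathcal S$ independently with probability $p=\frac{s}{5|\mathcal S|d}$ (capped at 1) to form $E'$. 3. If $|E'|>s$ the algorithm fails. Otherwise give $(V,E')$ to a single machine, compute a maximal matching $M'$ of it, and set $M:=M\cup M'$. 4. Let $I$ be the set of vertices of $G$ unmatched by $M$. If $|E[I]|>s$, set $\mathcal S:=E[I]$ and return to step 2. 5. Otherwise compute a maximal matching $M''$ of $G[I]$ and output $M\cup M''$. "With high probability" means with probability $1-o(1)$ as $n\to\infty$.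
   Formalization: The uniformity d is a fixed constant as n grows, and the constants hidden in O(log n), in Θ(d·n) and in "with high probability" may depend on d; the claim fails uniformly in d, e.g. for complete d-uniform hypergraphs with d = n^0.3. *)

theory Defs
  imports "HOL-Probability.Probability" "HOL-Library.Landau_Symbols" "HOL-Library.Disjoint_Sets"
begin

section \<open>Hypergraphs and matchings\<close>

definition uniform_hypergraph :: "nat \<Rightarrow> 'a set \<Rightarrow> 'a set set \<Rightarrow> bool" where
  "uniform_hypergraph d V E \<longleftrightarrow> finite V \<and> (\<forall>e\<in>E. e \<subseteq> V \<and> card e = d)"

definition matching :: "'a set set \<Rightarrow> 'a set set \<Rightarrow> bool" where
  "matching E M \<longleftrightarrow> M \<subseteq> E \<and> disjoint M"

definition maximal_matching :: "'a set set \<Rightarrow> 'a set set \<Rightarrow> bool" where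
  "maximal_matching E M \<longleftrightarrow> matching E M \<and> \<not> (\<exists>M'. matching E M' \<and> M \<subset> M')"

definition induced_edges :: "'a set set \<Rightarrow> 'a set \<Rightarrow> 'a set set" where
  "induced_edges E I = {e \<in> E. e \<subseteq> I}"

definition unmatched :: "'a set \<Rightarrow> 'a set set \<Rightarrow> 'a set" where
  "unmatched V M = V - \<Union>M"


section \<open>The algorithm Iterated-Sampling\<close>

definition sample_edges :: "real \<Rightarrow> 'a set set \<Rightarrow> 'a set set pmf" where
  "sample_edges p F = map_pmf (\<lambda>X. {e \<in> F. X e}) (Pi_pmf F False (\<lambda>_. bernoulli_pmf p))"

text \<open>
  \<open>Running M F\<close> is the state in which the sampling step is about to be executed with current
  matching \<open>M\<close> and current edge set \<open>F\<close> (the set \<open>\<S>\<close> of the algorithm).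
\<close>

datatype 'a sampling_state =
    Running "'a set set" "'a set set"
  | Failed
  | Finished "'a set set"

text \<open>
  One pass through the loop. The subroutine \<open>mm\<close> is the one used to compute maximal matchings:
  \<open>mm V F\<close> is its answer on the hypergraph with vertex set \<open>V\<close> and edge set \<open>F\<close>. If \<open>F\<close> is
  empty, the sampling probability is \<open>0\<close> (division by zero), but then there is nothing to sample.
\<close>

fun iteration ::
  "nat \<Rightarrow> nat \<Rightarrow> ('a set \<Rightarrow> 'a set set \<Rightarrow> 'a set set) \<Rightarrow> 'a set \<Rightarrow> 'a set set
    \<Rightarrow> 'a sampling_state \<Rightarrow> 'a sampling_state pmf" where
  "iteration d s mm V E (Running M F) =
     map_pmf
       (\<lambda>E'. if card E' > s then Failed
         else
           (let M1 = M \<union> mm V E';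
                I = unmatched V M1
            in if card (induced_edges E I) > s then Running M1 (induced_edges E I)
               else Finished (M1 \<union> mm I (induced_edges E I))))
       (sample_edges (min 1 (real s / (5 * real (card F) * real d))) F)"
| "iteration d s mm V E Failed = return_pmf Failed"
| "iteration d s mm V E (Finished M) = return_pmf (Finished M)"

text \<open>The distribution of the state after \<open>t\<close> passes through the loop.\<close>

primrec iterated_sampling ::
  "nat \<Rightarrow> nat \<Rightarrow> ('a set \<Rightarrow> 'a set set \<Rightarrow> 'a set set) \<Rightarrow> 'a set \<Rightarrow> 'a set set
    \<Rightarrow> nat \<Rightarrow> 'a sampling_state pmf" where
  "iterated_sampling d s mm V E 0 = return_pmf (Running {} E)"
| "iterated_sampling d s mm V E (Suc t) =
     bind_pmf (iterated_sampling d s mm V E t) (iteration d s mm V E)"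

fun sampling_result :: "'a sampling_state \<Rightarrow> 'a set set option" where
  "sampling_result (Finished M) = Some M"
| "sampling_result (Running M F) = None"
| "sampling_result Failed = None"


section \<open>The MPC model\<close>

text \<open>
  Machines are numbered \<open>0, \<dots>, k - 1\<close>. Data are lists of words, and a word is a natural number.
  The data of a machine at the beginning of a round are exactly the messages it has received,
  indexed by their senders: there is no other storage, so a machine keeps data by sending them to
  itself, and this is charged as communication. A configuration gives the data of each machine:
  \<open>C j i\<close> is the message that \<open>j\<close> has received from \<open>i\<close>.
\<close>

type_synonym mpc_data = "nat \<Rightarrow> nat list"
type_synonym mpc_config = "nat \<Rightarrow> mpc_data"

text \<open>
  A program maps the number of the current round, the number of a machine and the data of that
  machine to the (random) messages it sends, indexed by their receivers. It may be an arbitrary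
  function, since the local computational power is unrestricted; different machines use
  independent randomness.
\<close>

type_synonym mpc_program = "nat \<Rightarrow> nat \<Rightarrow> mpc_data \<Rightarrow> (nat \<Rightarrow> nat list) pmf"

definition mpc_round :: "nat \<Rightarrow> mpc_program \<Rightarrow> nat \<Rightarrow> mpc_config \<Rightarrow> mpc_config pmf" where
  "mpc_round k P r C =
     map_pmf (\<lambda>msg j i. if i < k \<and> j < k then msg i j else [])
       (Pi_pmf {..<k} (\<lambda>_. []) (\<lambda>i. P r i (C i)))"

primrec mpc_run :: "nat \<Rightarrow> mpc_program \<Rightarrow> mpc_config \<Rightarrow> nat \<Rightarrow> mpc_config pmf" where
  "mpc_run k P C 0 = return_pmf C"
| "mpc_run k P C (Suc r) = bind_pmf (mpc_run k P C r) (mpc_round k P r)"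

text \<open>
  \<open>b\<close> bounds the number of words that a machine has received (which is also the size of its
  data) and the number of words that it has sent; \<open>W\<close> bounds the words.
\<close>

definition mpc_within :: "nat \<Rightarrow> nat \<Rightarrow> nat \<Rightarrow> mpc_config \<Rightarrow> bool" where
  "mpc_within k b W C \<longleftrightarrow>
     (\<forall>j<k. (\<Sum>i<k. length (C j i)) \<le> b) \<and>
     (\<forall>i<k. (\<Sum>j<k. length (C j i)) \<le> b) \<and>
     (\<forall>j<k. \<forall>i<k. \<forall>x\<in>set (C j i). x < W)"

text \<open>
  \<open>D i\<close> lists the edges initially stored on machine \<open>i\<close>: each edge lies on exactly one machine,
  the assignment is otherwise arbitrary, and an edge takes up \<open>d\<close> words, namely its vertices.
\<close>

definition distributed_input ::
  "nat \<Rightarrow> nat \<Rightarrow> nat \<Rightarrow> nat set set \<Rightarrow> (nat \<Rightarrow> nat set list) \<Rightarrow> bool" where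
  "distributed_input d k b E D \<longleftrightarrow>
     distinct (concat (map D [0..<k])) \<and> set (concat (map D [0..<k])) = E \<and>
     (\<forall>i<k. d * length (D i) \<le> b)"

definition initial_config :: "nat \<Rightarrow> (nat \<Rightarrow> nat set list) \<Rightarrow> mpc_config" where
  "initial_config k D =
     (\<lambda>j i. if j < k \<and> i = j then concat (map sorted_list_of_set (D j)) else [])"

definition input_size :: "nat \<Rightarrow> nat \<Rightarrow> nat set set \<Rightarrow> nat" where
  "input_size d n E = n + d * card E"

end

theory Submission
  imports Defs "HOL-Real_Asymp.Real_Asymp"
begin

text \<open>
  Iterations: let \<open>\<mu> = s / (5 d)\<close> be the expected sample size, which is at least \<open>c n\<close>, and let \<open>W\<close>
  be the set of vertices matched by the sample. If the edges of \<open>F\<close> hit by \<open>W\<close> are fewer than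
  \<open>\<delta> |F|\<close>, then all of the sample lies in this small set, by maximality. The sample has at least
  \<open>\<mu> / 2\<close> edges except with exponentially small probability, and for fixed \<open>W\<close> the probability that
  \<open>\<mu> / 2\<close> sampled edges hit \<open>W\<close> is at most \<open>exp (- 2 n)\<close> when \<open>\<delta>\<close> is a small constant depending on
  \<open>c\<close>. By a union bound over the \<open>2\<^sup>n\<close> sets \<open>W\<close>, each iteration shrinks \<open>F\<close> by a constant factor,
  so \<open>O (log n)\<close> iterations suffice.

  Rounds: there are at most \<open>n\<^sup>L\<close> machines for a constant \<open>L\<close>, so trees of fan-out \<open>n\<close> have
  constant depth. The edges never move, except to machine \<open>0\<close>. An iteration consists of constantly
  many summations of local counts, each followed by a broadcast of at most \<open>n\<close> words: the current
  number of edges, the size of the sample (so that it is sent to machine \<open>0\<close> only if it fits), or the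
  set of matched vertices.
\<close>

section \<open>Sampled edge sets\<close>

text \<open>The matching is computed from the sample, so its vertex set cannot be held fixed while
  the sample is bounded. Hence the union over all \<open>2^n\<close> vertex sets, and hence the need
  for tails below \<open>2^(-n)\<close>: this is what memory of order \<open>d * n\<close> pays for.
  A mean that is only a small multiple \<open>c * n\<close> still suffices, because the tail for
  hitting a set of few edges can be made as small as needed by shrinking \<delta>.

  The analysis of the algorithm and that of the machines meet in an equality of distributions.
  Randomness enters in a single round of each iteration; since the edges are partitioned among the
  machines, independent local samples are jointly one global sample. All other rounds are
  deterministic, so that the contents of every machine can be described exactly by a small global
  state.

  The obstacle on the side of the machines is that their number may exceed the memory of each:
  machine 0 can neither hear from all of them nor write to all of them in one round. Moreover a
  machine remembers only what it sends to itself, so stored edges count as traffic in every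
  round.\<close>

lemma set_sample_edges_subset:
  assumes "finite F" "T \<in> set_pmf (sample_edges p F)"
  shows "T \<subseteq> F"
  using assms by (auto simp: sample_edges_def)

lemma sample_edges_one:
  assumes "finite F"
  shows "sample_edges 1 F = return_pmf F"
proof -
  have "bernoulli_pmf 1 = return_pmf True"
    by (intro pmf_eqI) (auto simp: indicator_def split: if_splits)
  then show ?thesis
    using assms by (simp add: sample_edges_def)
qed

lemma finite_set_sample_edges: "finite F \<Longrightarrow> finite (set_pmf (sample_edges p F))"
  by (rule finite_subset[of _ "Pow F"]) (auto dest: set_sample_edges_subset)

section \<open>Samples on a partitioned edge set\<close>

lemma sample_edges_Un:
  assumes "finite A" "finite B" "A \<inter> B = {}"
  shows "sample_edges p (A \<union> B) =
    map_pmf (\<lambda>(X, Y). X \<union> Y) (pair_pmf (sample_edges p A) (sample_edges p B))"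
proof -
  let ?b = "\<lambda>_. bernoulli_pmf p"
  have "sample_edges p (A \<union> B) =
    map_pmf (\<lambda>(f, g). {e \<in> A. f e} \<union> {e \<in> B. g e})
      (pair_pmf (Pi_pmf A False ?b) (Pi_pmf B False ?b))"
    unfolding sample_edges_def Pi_pmf_union[OF assms] map_pmf_comp
    by (intro map_pmf_cong refl) (use assms in \<open>auto split: if_splits\<close>)
  also have "\<dots> = map_pmf (\<lambda>(X, Y). X \<union> Y) (pair_pmf (sample_edges p A) (sample_edges p B))"
    unfolding sample_edges_def map_pair[symmetric] map_pmf_comp
    by (simp add: case_prod_unfold)
  finally show ?thesis .
qed

text \<open>Lets the map depend on the index: what a machine sends is a function of its local sample
  and of its own number.\<close>

lemma Pi_pmf_map_dep:
  assumes "finite A"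
  shows "Pi_pmf A dflt' (\<lambda>i. map_pmf (f i) (g i)) =
    map_pmf (\<lambda>h i. if i \<in> A then f i (h i) else dflt') (Pi_pmf A dflt g)"
  using assms by (simp add: map_pmf_def Pi_pmf_bind[where d' = dflt])

text \<open>The coin of each edge is tossed on exactly one machine, so independent local samples are
  the traces of one global sample. This identifies the sampling of the machines with that of the
  algorithm.\<close>

lemma Pi_pmf_sample_edges:
  fixes k :: nat
  assumes "disjoint_family_on G {..<k}" "\<And>i. i < k \<Longrightarrow> finite (G i)"
  shows "Pi_pmf {..<k} {} (\<lambda>i. sample_edges p (G i)) =
    map_pmf (\<lambda>T i. if i < k then T \<inter> G i else {}) (sample_edges p (\<Union>i<k. G i))"
  using assms
proof (induction k)
  case 0
  then show ?case by (simp add: sample_edges_def)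
next
  case (Suc k)
  let ?U = "\<Union>i<k. G i"
  have disj: "G k \<inter> G i = {}" if "i < k" for i
    using Suc.prems(1) that by (auto simp: disjoint_family_on_def)
  have fin: "finite (G k)" "finite ?U" using Suc.prems(2) by auto
  have IH: "Pi_pmf {..<k} {} (\<lambda>i. sample_edges p (G i)) =
    map_pmf (\<lambda>T i. if i < k then T \<inter> G i else {}) (sample_edges p ?U)"
    using Suc.prems by (intro Suc.IH) (auto simp: disjoint_family_on_def)
  have "Pi_pmf {..<Suc k} {} (\<lambda>i. sample_edges p (G i)) =
      map_pmf (\<lambda>(y, f). f(k := y)) (pair_pmf (sample_edges p (G k))
        (map_pmf (\<lambda>T i. if i < k then T \<inter> G i else {}) (sample_edges p ?U)))"
    unfolding lessThan_Suc by (subst Pi_pmf_insert) (auto simp: IH)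
  also have "\<dots> = map_pmf (\<lambda>(X, Y). (\<lambda>i. if i < k then Y \<inter> G i else {})(k := X))
      (pair_pmf (sample_edges p (G k)) (sample_edges p ?U))"
    by (simp add: pair_map_pmf2 map_pmf_comp case_prod_unfold)
  also have "\<dots> = map_pmf (\<lambda>(X, Y) i. if i < Suc k then (X \<union> Y) \<inter> G i else {})
      (pair_pmf (sample_edges p (G k)) (sample_edges p ?U))"
  proof (intro map_pmf_cong refl, clarsimp)
    fix X Y assume "X \<in> set_pmf (sample_edges p (G k))" "Y \<in> set_pmf (sample_edges p ?U)"
    then have XY: "X \<subseteq> G k" "Y \<subseteq> ?U" using set_sample_edges_subset fin by blast+
    have "X \<inter> G i = {}" if "i < k" for i using XY(1) disj[OF that] by blast
    moreover have "Y \<inter> G k = {}" using XY(2) disj by blast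
    ultimately show "(\<lambda>i. if i < k then Y \<inter> G i else {})(k := X) =
        (\<lambda>i. if i < Suc k then (X \<union> Y) \<inter> G i else {})"
      using XY(1) by (auto simp: fun_eq_iff Int_Un_distrib2 less_Suc_eq)
  qed
  also have "\<dots> = map_pmf (\<lambda>T i. if i < Suc k then T \<inter> G i else {}) (sample_edges p (G k \<union> ?U))"
    using disj fin by (subst sample_edges_Un) (auto simp: map_pmf_comp case_prod_unfold)
  also have "G k \<union> ?U = (\<Union>i<Suc k. G i)" by (auto simp: less_Suc_eq)
  finally show ?case .
qed

section \<open>Exponential moments and tail bounds\<close>

lemma expectation_sample_edges:
  assumes F: "finite F" and G: "G \<subseteq> F" and p: "0 \<le> p" "p \<le> 1" and z: "0 \<le> z"
  shows "measure_pmf.expectation (sample_edges p F) (\<lambda>T. z ^ card (T \<inter> G)) =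
    (1 + p * (z - 1)) ^ card G"
proof -
  let ?f = "\<lambda>e b. if e \<in> G \<and> b then z else (1::real)"
  have "finite G" using F G finite_subset by blast
  have "measure_pmf.expectation (sample_edges p F) (\<lambda>T. z ^ card (T \<inter> G)) =
    measure_pmf.expectation (Pi_pmf F False (\<lambda>_. bernoulli_pmf p)) (\<lambda>X. \<Prod>e\<in>F. ?f e (X e))"
    unfolding sample_edges_def integral_map_pmf
  proof (intro Bochner_Integration.integral_cong refl)
    fix X :: "'a set \<Rightarrow> bool"
    have "(\<Prod>e\<in>F. ?f e (X e)) = (\<Prod>e\<in>{e\<in>F. e \<in> G \<and> X e}. z)"
      using F by (intro prod.mono_neutral_cong_right) auto
    also have "{e\<in>F. e \<in> G \<and> X e} = {e\<in>F. X e} \<inter> G" by auto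
    finally show "z ^ card ({e\<in>F. X e} \<inter> G) = (\<Prod>e\<in>F. ?f e (X e))" by simp
  qed
  also have "\<dots> = (\<Prod>e\<in>F. measure_pmf.expectation (bernoulli_pmf p) (?f e))"
    using F z
    by (intro expectation_prod_Pi_pmf integrable_measure_pmf_finite) auto
  also have "\<dots> = (\<Prod>e\<in>F. if e \<in> G then 1 + p * (z - 1) else 1)"
    using p by (intro prod.cong refl) (auto simp: algebra_simps)
  also have "\<dots> = (\<Prod>e\<in>G. 1 + p * (z - 1))"
    using F G by (intro prod.mono_neutral_cong_right) auto
  finally show ?thesis by simp
qed

lemma expectation_sample_edges_le:
  assumes "finite F" "G \<subseteq> F" "0 \<le> p" "p \<le> 1" "0 \<le> z"
  shows "measure_pmf.expectation (sample_edges p F) (\<lambda>T. z ^ card (T \<inter> G))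
    \<le> exp (p * (z - 1) * card G)"
proof -
  have "0 \<le> (1 - p) + p * z" using assms by simp
  then have "0 \<le> 1 + p * (z - 1)" by (simp add: algebra_simps)
  then have "(1 + p * (z - 1)) ^ card G \<le> exp (p * (z - 1)) ^ card G"
    by (intro power_mono) (auto simp: add.commute exp_ge_add_one_self)
  then show ?thesis
    by (simp add: expectation_sample_edges[OF assms] exp_of_nat_mult[symmetric] mult.commute)
qed

text \<open>Markov's inequality for \<open>z ^ card (T \<inter> G)\<close>. Leaving the event in
  terms of powers of \<open>z\<close> covers both tails: for \<open>z > 1\<close> it bounds the
  cardinality from below, for \<open>z < 1\<close> from above.\<close>

lemma prob_sample_edges_le:
  fixes z a :: real
  assumes F: "finite F" and G: "G \<subseteq> F" and p: "0 \<le> p" "p \<le> 1" and z: "0 < z"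
  shows "measure_pmf.prob (sample_edges p F) {T. z powr a \<le> z ^ card (T \<inter> G)}
    \<le> z powr (- a) * exp (p * (z - 1) * card G)"
proof -
  let ?q = "sample_edges p F"
  have "measure_pmf.prob ?q {T \<in> space ?q. z powr a \<le> z ^ card (T \<inter> G)}
      \<le> measure_pmf.expectation ?q (\<lambda>T. z ^ card (T \<inter> G)) / z powr a"
    using z
    by (intro integral_Markov_inequality_measure[where A = "{}"])
       (auto intro!: integrable_measure_pmf_finite finite_set_sample_edges F)
  also have "\<dots> \<le> exp (p * (z - 1) * card G) / z powr a"
    using expectation_sample_edges_le[OF F G p] z by (intro divide_right_mono) auto
  finally show ?thesis by (simp add: powr_minus field_simps)
qed

lemma prob_sample_edges_ge:
  fixes z a :: real
  assumes "finite F" "G \<subseteq> F" "0 \<le> p" "p \<le> 1" and z: "1 \<le> z"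
  shows "measure_pmf.prob (sample_edges p F) {T. a \<le> card (T \<inter> G)}
    \<le> z powr (- a) * exp (p * (z - 1) * card G)"
proof -
  have "measure_pmf.prob (sample_edges p F) {T. a \<le> card (T \<inter> G)}
    \<le> measure_pmf.prob (sample_edges p F) {T. z powr a \<le> z ^ card (T \<inter> G)}"
    using z by (intro measure_pmf.finite_measure_mono)
      (auto simp: powr_realpow[symmetric] intro: powr_mono)
  also have "\<dots> \<le> z powr (- a) * exp (p * (z - 1) * card G)"
    using assms by (intro prob_sample_edges_le) auto
  finally show ?thesis .
qed

text \<open>The case \<open>z = 1/2\<close>, where the power is decreasing in the cardinality; the
  exponent comes from \<open>z - 1 = - 1/2\<close>.\<close>

lemma prob_sample_edges_less:
  fixes p a :: real
  assumes "finite F" "0 \<le> p" "p \<le> 1"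
  shows "measure_pmf.prob (sample_edges p F) {T. card T < a} \<le> 2 powr a * exp (- (p * card F / 2))"
proof -
  have sub: "T \<subseteq> F" if "T \<in> set_pmf (sample_edges p F)" for T
    using set_sample_edges_subset[OF assms(1) that] .
  have "measure_pmf.prob (sample_edges p F) {T. card T < a}
    \<le> measure_pmf.prob (sample_edges p F) {T. (1/2) powr a \<le> (1/2::real) ^ card (T \<inter> F)}"
  proof (rule measure_pmf.finite_measure_mono_AE)
    show "AE T in measure_pmf (sample_edges p F). T \<in> {T. real (card T) < a} \<longrightarrow>
        T \<in> {T. (1/2) powr a \<le> (1/2::real) ^ card (T \<inter> F)}"
      using sub by (auto simp: AE_measure_pmf_iff powr_realpow[symmetric] Int_absorb2 intro!: powr_mono')
  qed auto
  also have "\<dots> \<le> (1/2) powr (- a) * exp (p * (1/2 - 1) * card F)"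
    using assms by (intro prob_sample_edges_le) auto
  also have "\<dots> = 2 powr a * exp (- (p * card F / 2))"
    by (simp add: powr_minus_divide powr_divide)
  finally show ?thesis .
qed

section \<open>One pass through the loop\<close>

text \<open>Otherwise \<open>e\<close> could be added to \<open>M\<close>. The empty edge has to be
  excluded: it is disjoint from everything and may already lie in \<open>M\<close>.\<close>

lemma maximal_matching_hits:
  assumes "maximal_matching E M" "e \<in> E" "e \<noteq> {}"
  shows "e \<inter> \<Union>M \<noteq> {}"
proof
  assume *: "e \<inter> \<Union>M = {}"
  with assms(3) have "e \<notin> M" by auto
  moreover have "matching E (insert e M)"
    using assms * by (auto simp: maximal_matching_def matching_def disjoint_def)
  ultimately show False
    using assms(1) by (auto simp: maximal_matching_def)
qed

lemma maximal_matchingI: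
  assumes "matching E M" "\<And>e. e \<in> E \<Longrightarrow> e \<notin> M \<Longrightarrow> e \<inter> \<Union>M \<noteq> {}"
  shows "maximal_matching E M"
  unfolding maximal_matching_def
proof (intro conjI notI assms(1))
  assume "\<exists>M'. matching E M' \<and> M \<subset> M'"
  then obtain M' e where M': "matching E M'" "M \<subset> M'" "e \<in> M'" "e \<notin> M" by blast
  then have "e \<inter> \<Union>M \<noteq> {}" using assms(2) by (auto simp: matching_def)
  then obtain f where "f \<in> M" "e \<inter> f \<noteq> {}" by blast
  moreover have "e \<noteq> f" using M'(4) \<open>f \<in> M\<close> by auto
  ultimately show False using M' \<open>f \<in> M\<close> unfolding matching_def disjoint_def by blast
qed

text \<open>The bad event ranges over all maximal matchings of the sample, so the bound serves every
  subroutine. The two copies of \<open>exp (- c * card V / 8)\<close> pay for a sample that is too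
  large or too small, the last term for the union over the vertex sets.\<close>

lemma prob_bad_sample:
  fixes c \<delta> :: real
  assumes V: "finite V" and F: "uniform_hypergraph d V F" and d: "d \<ge> 1" and c: "c > 0"
    and s: "c * card V \<le> s / (5 * d)"
  defines "\<delta> \<equiv> exp (- (2 + 4 / c))"
  shows "measure_pmf.prob (sample_edges (min 1 (real s / (5 * real (card F) * real d))) F)
      {T. card T > s \<or> (\<exists>M. maximal_matching T M \<and>
            (1 - \<delta>) * card F < card {e \<in> F. e \<inter> \<Union>M = {}})}
    \<le> 2 * exp (- c * card V / 8) + exp (- real (card V))"
proof -
  define \<mu> where "\<mu> = s / (5 * d)"
  define p where "p = min 1 (real s / (5 * real (card F) * real d))"
  define bad where "bad = {T. card T > s \<or> (\<exists>M. maximal_matching T M \<and>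
            (1 - \<delta>) * card F < card {e \<in> F. e \<inter> \<Union>M = {}})}"
  have finF: "finite F"
    using F V by (auto simp: uniform_hypergraph_def intro: finite_subset[of _ "Pow V"])
  have ne: "e \<noteq> {}" if "e \<in> F" for e
    using that F d by (auto simp: uniform_hypergraph_def)
  have \<delta>: "0 < \<delta>" "\<delta> < 1"
    using add_pos_pos[of 2 "4 / c"] c by (auto simp: \<delta>_def)
  have p01: "0 \<le> p" "p \<le> 1" by (auto simp: p_def)
  have "\<mu> \<ge> 0" by (simp add: \<mu>_def)
  have \<mu>s: "5 * \<mu> \<le> s"
    using divide_left_mono[of 1 "real d" "real s"] d by (simp add: \<mu>_def)
  have c\<mu>: "c * card V \<le> \<mu>" using s by (simp add: \<mu>_def)
  have sub: "T \<subseteq> F" if "T \<in> set_pmf (sample_edges p F)" for T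
    using set_sample_edges_subset[OF finF that] .
  show ?thesis
    unfolding p_def[symmetric] bad_def[symmetric]
  proof (cases "F = {}")
    case True
    have "set_pmf (sample_edges p F) \<inter> bad = {}"
      using sub unfolding bad_def True by force
    then have "measure_pmf.prob (sample_edges p F) bad = 0"
      by (auto simp: measure_pmf_zero_iff)
    then show "measure_pmf.prob (sample_edges p F) bad
      \<le> 2 * exp (- c * card V / 8) + exp (- real (card V))" by simp
  next
    case Fne: False
    then have Fpos: "card F > 0" using finF by (simp add: card_gt_0_iff)
    show "measure_pmf.prob (sample_edges p F) bad
      \<le> 2 * exp (- c * card V / 8) + exp (- real (card V))"
    \<comment> \<open>At probability 1 the sample is all of \<open>F\<close>: it fits, and a maximal
      matching of \<open>F\<close> misses no edge. Below the cap the mean \<open>p * card F\<close>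
      equals \<mu> exactly.\<close>
    proof (cases "p = 1")
      case True
      have Fs: "card F \<le> s"
      proof -
        have "1 \<le> real s / (5 * real (card F) * real d)" using True by (simp add: p_def)
        then have "5 * real (card F) * real d \<le> s" using Fpos d by (simp add: field_simps)
        moreover have "real (card F) * 1 \<le> (5 * real (card F)) * real d"
          using d by (intro mult_mono) auto
        ultimately show ?thesis by linarith
      qed
      have none: "{e \<in> F. e \<inter> \<Union>M = {}} = {}" if "maximal_matching F M" for M
        using maximal_matching_hits[OF that] ne by auto
      have shrinks: "\<not> (1 - \<delta>) * card F < card {e \<in> F. e \<inter> \<Union>M = {}}" if "maximal_matching F M" for M
        unfolding none[OF that] using \<delta> by (simp add: not_less)
      then have "F \<notin> bad" using Fs unfolding bad_def by (auto dest: shrinks)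
      then have "measure_pmf.prob (sample_edges p F) bad = 0"
        using finF by (simp add: True sample_edges_one)
      then show ?thesis by simp
    next
      case False
      then have p: "p = real s / (5 * real (card F) * real d)" by (auto simp: p_def min_def)
      have p\<mu>: "p * card F = \<mu>" using Fpos d by (simp add: p \<mu>_def)
      define A1 where "A1 = {T. real s \<le> card (T \<inter> F)}"
      define A2 where "A2 = {T :: 'a set set. real (card T) < \<mu> / 2}"
      define H where "H = (\<lambda>W. {e \<in> F. e \<inter> W \<noteq> {}})"
      \<comment> \<open>The matched set is random, but these candidates for it are not; the tail
        bound applies to each of them separately.\<close>
      define Ws where "Ws = {W \<in> Pow V. card (H W) \<le> \<delta> * card F}"
      define A3 where "A3 = (\<lambda>W. {T. \<mu> / 2 \<le> card (T \<inter> H W)})"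
      have HF: "H W \<subseteq> F" for W by (auto simp: H_def)
      have cover: "T \<in> A1 \<union> A2 \<union> (\<Union>W\<in>Ws. A3 W)" if T: "T \<subseteq> F" "T \<in> bad" for T
      proof (cases "card T > s")
        case True
        then show ?thesis using T(1) by (simp add: A1_def Int_absorb2)
      next
        case False
        then obtain M where M: "maximal_matching T M"
          "(1 - \<delta>) * card F < card {e \<in> F. e \<inter> \<Union>M = {}}"
          using T(2) by (auto simp: bad_def)
        have MF: "M \<subseteq> F" using M(1) T(1) by (auto simp: maximal_matching_def matching_def)
        then have "\<Union>M \<in> Pow V" using F by (auto simp: uniform_hypergraph_def)
        moreover have "card (H (\<Union>M)) \<le> \<delta> * card F"
        proof -
          have "F = H (\<Union>M) \<union> {e \<in> F. e \<inter> \<Union>M = {}}" by (auto simp: H_def)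
          moreover have "H (\<Union>M) \<inter> {e \<in> F. e \<inter> \<Union>M = {}} = {}" by (auto simp: H_def)
          ultimately have "card F = card (H (\<Union>M)) + card {e \<in> F. e \<inter> \<Union>M = {}}"
            using finF card_Un_disjoint[of "H (\<Union>M)" "{e \<in> F. e \<inter> \<Union>M = {}}"] HF
            by (metis finite_Un)
          then have "real (card F) = card (H (\<Union>M)) + card {e \<in> F. e \<inter> \<Union>M = {}}" by simp
          then show ?thesis using M(2) by (simp add: algebra_simps)
        qed
        ultimately have W: "\<Union>M \<in> Ws" by (simp add: Ws_def)
        have "T \<subseteq> H (\<Union>M)"
          using maximal_matching_hits[OF M(1)] T(1) ne by (auto simp: H_def)
        then have "card (T \<inter> H (\<Union>M)) = card T" by (simp add: Int_absorb2)
        then have "T \<in> A2 \<union> A3 (\<Union>M)" by (auto simp: A2_def A3_def)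
        then show ?thesis using W by blast
      qed
      have "measure_pmf.prob (sample_edges p F) bad
          \<le> measure_pmf.prob (sample_edges p F) (A1 \<union> A2 \<union> (\<Union>W\<in>Ws. A3 W))"
        by (rule measure_pmf.finite_measure_mono_AE) (use cover sub in \<open>auto simp: AE_measure_pmf_iff\<close>)
      also have "\<dots> \<le> measure_pmf.prob (sample_edges p F) (A1 \<union> A2)
          + measure_pmf.prob (sample_edges p F) (\<Union>W\<in>Ws. A3 W)"
        by (rule measure_Un_le) auto
      also have "measure_pmf.prob (sample_edges p F) (A1 \<union> A2) \<le>
          measure_pmf.prob (sample_edges p F) A1 + measure_pmf.prob (sample_edges p F) A2"
        by (rule measure_Un_le) auto
      also have "measure_pmf.prob (sample_edges p F) A1 \<le> exp (- c * card V / 8)"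
      proof -
        have "measure_pmf.prob (sample_edges p F) A1 \<le> 2 powr (- real s) * exp (p * (2 - 1) * card F)"
          unfolding A1_def using finF p01 by (intro prob_sample_edges_ge) auto
        also have "\<dots> = exp (\<mu> - s * ln 2)" using p\<mu> by (simp add: powr_def exp_diff exp_minus field_simps)
        also have "\<dots> \<le> exp (- c * card V / 8)"
        proof -
          \<comment> \<open>The 5 in the sampling probability gives the room: the exponent is at
            most \<open>\<mu> - s / 2\<close>, and \<open>s \<ge> 5 * \<mu>\<close>.\<close>
          have "s * (1 / 2) \<le> s * ln 2" using ln2_ge_two_thirds by (intro mult_left_mono) auto
          then show ?thesis using \<mu>s c\<mu> \<open>\<mu> \<ge> 0\<close> by simp
        qed
        finally show ?thesis .
      qed
      also have "measure_pmf.prob (sample_edges p F) A2 \<le> exp (- c * card V / 8)"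
      proof -
        have "measure_pmf.prob (sample_edges p F) A2 \<le> 2 powr (\<mu> / 2) * exp (- (p * card F / 2))"
          unfolding A2_def using prob_sample_edges_less[OF finF p01, of "\<mu> / 2"] by simp
        also have "\<dots> = exp (\<mu> / 2 * ln 2 - \<mu> / 2)"
          by (simp add: powr_def p\<mu> exp_add[symmetric])
        also have "\<dots> \<le> exp (- c * card V / 8)"
        proof -
          \<comment> \<open>Bounding \<open>ln 2\<close> by 3/4 leaves \<open>- \<mu> / 8\<close> in
            the exponent, the origin of the 8 in the statement.\<close>
          have "\<mu> / 2 * ln 2 \<le> \<mu> / 2 * (3 / 4)"
            using ln2_le_25_over_36 \<open>\<mu> \<ge> 0\<close> by (intro mult_left_mono) auto
          then show ?thesis using c\<mu> by simp
        qed
        finally show ?thesis .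
      qed
      also have "measure_pmf.prob (sample_edges p F) (\<Union>W\<in>Ws. A3 W) \<le> exp (- real (card V))"
      proof -
        have finWs: "finite Ws" using V by (simp add: Ws_def)
        have "measure_pmf.prob (sample_edges p F) (\<Union>W\<in>Ws. A3 W)
            \<le> (\<Sum>W\<in>Ws. measure_pmf.prob (sample_edges p F) (A3 W))"
          using finWs by (intro measure_UNION_le) auto
        also have "\<dots> \<le> (\<Sum>W\<in>Ws. exp (- 2 * real (card V)))"
        proof (rule sum_mono)
          fix W assume W: "W \<in> Ws"
          \<comment> \<open>With \<open>z = 1 / \<delta>\<close> the moment is at most
            \<open>exp \<mu>\<close>, while \<open>\<delta> powr (\<mu> / 2)\<close> equals
            \<open>exp (- \<mu> - 2 * \<mu> / c)\<close>. So the 2 in the definition of \<delta>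
            cancels \<open>exp \<mu>\<close>, and the \<open>4 / c\<close> leaves
            \<open>exp (- 2 * card V)\<close>.\<close>
          have z: "1 \<le> 1 / \<delta>" using \<delta> by simp
          have "p * (1 / \<delta> - 1) * card (H W) \<le> p * (1 / \<delta>) * (\<delta> * card F)"
            using W z p01 \<delta> by (intro mult_mono) (auto simp: Ws_def)
          also have "\<dots> = \<mu>" using \<delta> p\<mu> by simp
          finally have "exp (p * (1 / \<delta> - 1) * card (H W)) \<le> exp \<mu>" by simp
          moreover have "measure_pmf.prob (sample_edges p F) (A3 W)
              \<le> (1 / \<delta>) powr (- (\<mu> / 2)) * exp (p * (1 / \<delta> - 1) * card (H W))"
            unfolding A3_def using finF p01 z HF by (intro prob_sample_edges_ge) auto
          ultimately have "measure_pmf.prob (sample_edges p F) (A3 W)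
              \<le> (1 / \<delta>) powr (- (\<mu> / 2)) * exp \<mu>"
            by (meson mult_left_mono order_trans powr_ge_zero)
          also have "(1 / \<delta>) powr (- (\<mu> / 2)) = exp (- ((2 + 4 / c) * (\<mu> / 2)))"
            by (simp add: powr_def \<delta>_def ln_div)
          also have "exp (- ((2 + 4 / c) * (\<mu> / 2))) * exp \<mu> = exp (- 2 * (\<mu> / c))"
            by (simp add: exp_add[symmetric] algebra_simps)
          also have "\<dots> \<le> exp (- 2 * real (card V))"
            using c\<mu> c by (simp add: field_simps)
          finally show "measure_pmf.prob (sample_edges p F) (A3 W) \<le> exp (- 2 * real (card V))"
            by simp
        qed
        also have "\<dots> \<le> 2 ^ card V * exp (- 2 * real (card V))"
        proof -
          have "card Ws \<le> card (Pow V)" using V by (intro card_mono) (auto simp: Ws_def)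
          then have "real (card Ws) \<le> 2 ^ card V" by (simp add: card_Pow V) 
          then show ?thesis by simp
        qed
        also have "\<dots> \<le> exp 1 ^ card V * exp (- 2 * real (card V))"
          using exp_ge_add_one_self[of "1::real"] by (intro mult_right_mono power_mono) auto
        also have "\<dots> = exp (- real (card V))"
          by (simp add: exp_of_nat_mult[symmetric] exp_add[symmetric])
        finally show ?thesis .
      qed
      finally show ?thesis by simp
    qed
  qed
qed

section \<open>The number of iterations\<close>

text \<open>\<open>B\<close> collects the states already given up; from all others a step reaches
  \<open>A\<close> with probability at most \<eta>. Iterated, this makes failure probabilities add
  up.\<close>

lemma prob_bind_pmf_le:
  fixes \<eta> :: real
  assumes "\<And>x. x \<in> set_pmf p \<Longrightarrow> x \<notin> B \<Longrightarrow> measure_pmf.prob (f x) A \<le> \<eta>" and "0 \<le> \<eta>"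
  shows "measure_pmf.prob (bind_pmf p f) A \<le> measure_pmf.prob p B + \<eta>"
proof -
  have "emeasure (bind_pmf p f) A = (\<integral>\<^sup>+ x. emeasure (f x) A \<partial>p)"
    by (rule emeasure_bind_pmf)
  also have "\<dots> \<le> (\<integral>\<^sup>+ x. indicator B x + ennreal \<eta> \<partial>p)"
  proof (intro nn_integral_mono_AE, simp add: AE_measure_pmf_iff, intro ballI)
    fix x assume x: "x \<in> set_pmf p"
    show "emeasure (f x) A \<le> indicator B x + ennreal \<eta>"
    proof (cases "x \<in> B")
      case True
      have "emeasure (f x) A \<le> 1" by (rule measure_pmf.emeasure_le_1)
      then show ?thesis using True by (simp add: add_increasing2)
    next
      case False
      then show ?thesis using assms(1)[OF x False]
        by (simp add: measure_pmf.emeasure_eq_measure ennreal_leI)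
    qed
  qed
  also have "\<dots> = emeasure p B + ennreal \<eta>"
    by (subst nn_integral_add) auto
  also have "\<dots> = ennreal (measure_pmf.prob p B + \<eta>)"
    using assms(2) by (simp add: measure_pmf.emeasure_eq_measure)
  finally show ?thesis
    using assms(2) by (simp add: measure_pmf.emeasure_eq_measure del: ennreal_plus)
qed

lemma induced_unmatched:
  assumes "\<And>e. e \<in> E \<Longrightarrow> e \<subseteq> V"
  shows "induced_edges E (unmatched V M) = {e \<in> E. e \<inter> \<Union>M = {}}"
  using assms by (auto simp: induced_edges_def unmatched_def)

lemma uniform_hypergraph_subset:
  "uniform_hypergraph d V E \<Longrightarrow> F \<subseteq> E \<Longrightarrow> uniform_hypergraph d V F"
  by (auto simp: uniform_hypergraph_def)

lemma uniform_hypergraph_finite: "uniform_hypergraph d V E \<Longrightarrow> finite E"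
  by (auto simp: uniform_hypergraph_def intro: finite_subset[of _ "Pow V"])

lemma uniform_hypergraph_nonempty:
  "uniform_hypergraph d V E \<Longrightarrow> d \<ge> 1 \<Longrightarrow> e \<in> E \<Longrightarrow> e \<noteq> {}"
  by (auto simp: uniform_hypergraph_def)

section \<open>Sizes and extensions of matchings\<close>

lemma card_uniform_hypergraph_le:
  assumes "uniform_hypergraph d V E"
  shows "card E \<le> card V ^ d"
proof -
  have V: "finite V" using assms by (simp add: uniform_hypergraph_def)
  have "card E \<le> card {e. e \<subseteq> V \<and> card e = d}"
    using assms V by (intro card_mono) (auto simp: uniform_hypergraph_def)
  also have "\<dots> = card V choose d" by (rule n_subsets[OF V])
  also have "\<dots> \<le> card V ^ d"
  proof (cases "d \<le> card V")
    case True then show ?thesis by (rule binomial_le_pow)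
  qed (simp add: binomial_eq_0)
  finally show ?thesis .
qed

text \<open>The edges are disjoint and, as \<open>d \<ge> 1\<close>, each uses up a vertex. This
  bounds the space that the matching takes on machine 0.\<close>

lemma card_matching_le:
  assumes "matching E M" "uniform_hypergraph d V E" "d \<ge> 1"
  shows "card M \<le> card V"
proof -
  have V: "finite V" using assms by (simp add: uniform_hypergraph_def)
  have M: "M \<subseteq> E" "disjoint M" using assms by (auto simp: matching_def)
  have "finite M" using M uniform_hypergraph_finite[OF assms(2)] finite_subset by blast
  have fe: "finite e" "e \<noteq> {}" "e \<subseteq> V" if "e \<in> M" for e
    using that M assms uniform_hypergraph_nonempty[OF assms(2,3)] V
    by (auto simp: uniform_hypergraph_def intro: finite_subset)
  have "card M = (\<Sum>e\<in>M. 1)" by simp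
  also have "\<dots> \<le> (\<Sum>e\<in>M. card e)" using fe by (intro sum_mono) (simp add: Suc_le_eq card_gt_0_iff)
  also have "\<dots> = card (\<Union>M)"
    using fe M by (intro card_Union_disjoint[symmetric]) (auto simp: disjoint_def pairwise_def disjnt_def)
  also have "\<dots> \<le> card V" using fe V by (intro card_mono) auto
  finally show ?thesis .
qed

lemma matching_Un:
  assumes "matching E M" "F \<subseteq> {e \<in> E. e \<inter> \<Union>M = {}}" "matching F M'"
  shows "matching E (M \<union> M')"
proof -
  have "M \<subseteq> E" "disjoint M" "M' \<subseteq> F" "disjoint M'" using assms by (auto simp: matching_def)
  moreover from this have "a \<inter> b = {}" if "a \<in> M" "b \<in> M'" for a b
    using assms(2) that by blast
  then have "\<Union>M \<inter> \<Union>M' = {}" by blast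
  ultimately show ?thesis
    using assms(2) disjoint_union[of M M'] unfolding matching_def by blast
qed

text \<open>An edge missed by \<open>M\<close> belongs to the second hypergraph, where maximality of
  \<open>M'\<close> ensures that it is hit.\<close>

lemma maximal_matching_Un:
  assumes "matching E M" "maximal_matching {e \<in> E. e \<inter> \<Union>M = {}} M'" "{} \<notin> E"
  shows "maximal_matching E (M \<union> M')"
proof (rule maximal_matchingI)
  show "matching E (M \<union> M')"
    using assms by (intro matching_Un[OF assms(1) subset_refl]) (auto simp: maximal_matching_def)
  fix e assume e: "e \<in> E" "e \<notin> M \<union> M'"
  show "e \<inter> \<Union>(M \<union> M') \<noteq> {}"
  proof (cases "e \<inter> \<Union>M = {}")
    case True
    then have "e \<inter> \<Union>M' \<noteq> {}"
      using e assms(3) by (intro maximal_matching_hits[OF assms(2)]) auto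
    then show ?thesis by blast
  qed blast
qed

text \<open>The invariant along good passes. The loop resumes only with more than \<open>s\<close>
  edges, whereas the initial state is entered unconditionally; hence the guard \<open>t > 0\<close>.
  For \<open>s \<ge> 1\<close> this lower bound eventually contradicts the geometric upper bound,
  and only \<open>Finished\<close> remains.\<close>

fun shrunk_state :: "nat \<Rightarrow> real \<Rightarrow> 'a set set \<Rightarrow> nat \<Rightarrow> 'a sampling_state \<Rightarrow> bool" where
  "shrunk_state s \<gamma> E t (Running M F) \<longleftrightarrow> matching E M \<and> F = {e \<in> E. e \<inter> \<Union>M = {}} \<and>
     real (card F) \<le> \<gamma> ^ t * real (card E) \<and> (t > 0 \<longrightarrow> card F > s)"
| "shrunk_state s \<gamma> E t (Finished M) \<longleftrightarrow> maximal_matching E M"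
| "shrunk_state s \<gamma> E t Failed \<longleftrightarrow> False"

text \<open>The invariant is lost only through a bad sample, and the bound for bad samples does not
  depend on the current edge set; so every pass costs the same amount. \<open>Finished\<close>
  states stay put.\<close>

lemma prob_not_shrunk_state:
  fixes c :: real
  assumes E: "uniform_hypergraph d V E" and d: "d \<ge> 1" and c: "c > 0"
    and s: "c * card V \<le> s / (5 * d)"
    and mm: "\<And>V F. uniform_hypergraph d V F \<Longrightarrow> maximal_matching F (mm V F)"
  defines "\<gamma> \<equiv> 1 - exp (- (2 + 4 / c))"
  shows "measure_pmf.prob (iterated_sampling d s mm V E t) {st. \<not> shrunk_state s \<gamma> E t st}
    \<le> t * (2 * exp (- c * card V / 8) + exp (- real (card V)))"
proof (induction t)
  case 0
  have "shrunk_state s \<gamma> E 0 (Running {} E)" by (simp add: matching_def)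
  then show ?case by simp
next
  case (Suc t)
  define \<eta> where "\<eta> = 2 * exp (- c * card V / 8) + exp (- real (card V))"
  have \<gamma>: "0 \<le> \<gamma>" using add_pos_pos[of 2 "4 / c"] c by (auto simp: \<gamma>_def)
  have finV: "finite V" and subV: "\<And>e. e \<in> E \<Longrightarrow> e \<subseteq> V"
    using E by (auto simp: uniform_hypergraph_def)
  have ne: "{} \<notin> E" using uniform_hypergraph_nonempty[OF E d] by blast
  have step: "measure_pmf.prob (iteration d s mm V E st) {st. \<not> shrunk_state s \<gamma> E (Suc t) st} \<le> \<eta>"
    if st: "st \<notin> {st. \<not> shrunk_state s \<gamma> E t st}" for st
  proof (cases st)
    case (Running M F)
    with st have M: "matching E M" and F: "F = {e \<in> E. e \<inter> \<Union>M = {}}"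
      and cF: "card F \<le> \<gamma> ^ t * card E" by auto
    have FE: "F \<subseteq> E" using F by auto
    have unF: "uniform_hypergraph d V F" by (rule uniform_hypergraph_subset[OF E FE])
    have finF: "finite F" by (rule uniform_hypergraph_finite[OF unF])
    let ?q = "sample_edges (min 1 (real s / (5 * real (card F) * real d))) F"
    let ?bad = "{T. card T > s \<or> (\<exists>M. maximal_matching T M \<and>
            (1 - exp (- (2 + 4 / c))) * card F < card {e \<in> F. e \<inter> \<Union>M = {}})}"
    have "measure_pmf.prob (iteration d s mm V E st) {st. \<not> shrunk_state s \<gamma> E (Suc t) st}
        \<le> measure_pmf.prob ?q ?bad"
    proof (unfold Running iteration.simps measure_map_pmf, rule measure_pmf.finite_measure_mono_AE)
      show "AE T in measure_pmf ?q. T \<in> (\<lambda>E'. if s < card E' then Failed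
               else let M1 = M \<union> mm V E'; I = unmatched V M1
                    in if s < card (induced_edges E I) then Running M1 (induced_edges E I)
                       else Finished (M1 \<union> mm I (induced_edges E I))) -`
            {st. \<not> shrunk_state s \<gamma> E (Suc t) st} \<longrightarrow> T \<in> ?bad"
      proof (unfold AE_measure_pmf_iff, intro ballI impI, rule ccontr)
        fix T assume "T \<in> set_pmf ?q" and T: "T \<in> (\<lambda>E'. if s < card E' then Failed
               else let M1 = M \<union> mm V E'; I = unmatched V M1
                    in if s < card (induced_edges E I) then Running M1 (induced_edges E I)
                       else Finished (M1 \<union> mm I (induced_edges E I))) -`
            {st. \<not> shrunk_state s \<gamma> E (Suc t) st}" and nb: "T \<notin> ?bad"
        then have TF: "T \<subseteq> F" using set_sample_edges_subset[OF finF] by blast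
        define M1 where "M1 = M \<union> mm V T"
        define I where "I = unmatched V M1"
        have mmT: "maximal_matching T (mm V T)" by (rule mm[OF uniform_hypergraph_subset[OF unF TF]])
        have M1: "matching E M1"
          unfolding M1_def using mmT TF F
          by (intro matching_Un[OF M subset_refl])
             (auto simp: maximal_matching_def matching_def)
        have EI: "induced_edges E I = {e \<in> E. e \<inter> \<Union>M1 = {}}"
          unfolding I_def by (rule induced_unmatched[OF subV])
        \<comment> \<open>\<open>F\<close> already consists of the edges missed by \<open>M\<close>,
          so what remains are the edges of \<open>F\<close> missed by the new matching: the number
          that a good sample controls.\<close>
        also have "\<dots> = {e \<in> F. e \<inter> \<Union>(mm V T) = {}}"
          unfolding F M1_def by auto
        finally have EI': "induced_edges E I = {e \<in> F. e \<inter> \<Union>(mm V T) = {}}" .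
        have cT: "card T \<le> s" using nb by auto
        have "card (induced_edges E I) \<le> \<gamma> * card F"
          using nb mmT unfolding EI' \<gamma>_def by (auto simp: not_less)
        also have "\<dots> \<le> \<gamma> * (\<gamma> ^ t * card E)"
          using cF \<gamma> by (intro mult_left_mono) auto
        finally have small: "card (induced_edges E I) \<le> \<gamma> ^ Suc t * card E" by simp
        have "uniform_hypergraph d I (induced_edges E I)"
          using E by (auto simp: uniform_hypergraph_def induced_edges_def I_def unmatched_def)
        then have "maximal_matching {e \<in> E. e \<inter> \<Union>M1 = {}} (mm I (induced_edges E I))"
          using mm[of I "induced_edges E I"] EI by simp
        then have "maximal_matching E (M1 \<union> mm I (induced_edges E I))"
          by (rule maximal_matching_Un[OF M1 _ ne])
        then show False
          using T cT small M1 EI unfolding vimage_def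
          by (auto simp: Let_def M1_def[symmetric] I_def[symmetric] split: if_splits)
      qed
    qed auto
    also have "\<dots> \<le> \<eta>"
      unfolding \<eta>_def by (rule prob_bad_sample[OF finV unF d c s])
    finally show ?thesis .
  qed (use st in \<open>auto simp: \<eta>_def\<close>)
  have "measure_pmf.prob (iterated_sampling d s mm V E (Suc t)) {st. \<not> shrunk_state s \<gamma> E (Suc t) st}
     \<le> measure_pmf.prob (iterated_sampling d s mm V E t) {st. \<not> shrunk_state s \<gamma> E t st} + \<eta>"
    unfolding iterated_sampling.simps by (intro prob_bind_pmf_le step) (auto simp: \<eta>_def)
  also have "\<dots> \<le> t * \<eta> + \<eta>" using Suc.IH by (simp add: \<eta>_def)
  finally show ?case by (simp add: \<eta>_def algebra_simps)
qed

text \<open>A state still running would have more than \<open>s \<ge> 1\<close> edges, but at most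
  one by the choice of \<open>t\<close>.\<close>

lemma prob_iterated_sampling_maximal:
  fixes c :: real
  assumes E: "uniform_hypergraph d V E" and d: "d \<ge> 1" and c: "c > 0"
    and s: "c * card V \<le> s / (5 * d)" and s1: "s \<ge> 1"
    and mm: "\<And>V F. uniform_hypergraph d V F \<Longrightarrow> maximal_matching F (mm V F)"
    and t: "t \<ge> 1" "(1 - exp (- (2 + 4 / c))) ^ t * card V ^ d \<le> (1::real)"
  shows "measure_pmf.prob (map_pmf sampling_result (iterated_sampling d s mm V E t))
      {r. \<exists>M. r = Some M \<and> maximal_matching E M}
    \<ge> 1 - t * (2 * exp (- c * card V / 8) + exp (- real (card V)))"
proof -
  let ?\<gamma> = "1 - exp (- (2 + 4 / c)) :: real"
  let ?q = "iterated_sampling d s mm V E t"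
  have \<gamma>: "0 \<le> ?\<gamma>" using add_pos_pos[of 2 "4 / c"] c by auto
  have "\<exists>M. sampling_result st = Some M \<and> maximal_matching E M" if "shrunk_state s ?\<gamma> E t st" for st
  proof (cases st)
    case (Running M F)
    have "real (card F) \<le> ?\<gamma> ^ t * card E" using that unfolding Running shrunk_state.simps by blast
    also have "\<dots> \<le> ?\<gamma> ^ t * card V ^ d"
      using card_uniform_hypergraph_le[OF E] \<gamma>
      by (intro mult_left_mono zero_le_power) (simp_all flip: of_nat_power)
    also have "\<dots> \<le> 1" using t(2) by simp
    finally show ?thesis using that Running t(1) s1 by simp
  qed (use that in auto)
  then have "measure_pmf.prob ?q {st. shrunk_state s ?\<gamma> E t st}
    \<le> measure_pmf.prob ?q (sampling_result -` {r. \<exists>M. r = Some M \<and> maximal_matching E M})"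
    by (intro measure_pmf.finite_measure_mono) auto
  moreover have "measure_pmf.prob ?q {st. shrunk_state s ?\<gamma> E t st} =
      1 - measure_pmf.prob ?q {st. \<not> shrunk_state s ?\<gamma> E t st}"
    using measure_pmf.prob_compl[of "{st. \<not> shrunk_state s ?\<gamma> E t st}" ?q]
    by (simp add: Compl_eq_Diff_UNIV[symmetric] Collect_neg_eq)
  moreover note prob_not_shrunk_state[where t = t and mm = mm, OF E d c s mm]
  ultimately show ?thesis by simp
qed

section \<open>Programs exchanging sets of items\<close>

text \<open>
  Programs are described at the level of messages that are finite sets of items from a
  universe \<open>U\<close>; an injection \<open>enc\<close> of \<open>U\<close> into the words turns them into MPC programs. A machine
  only looks at the union of the messages it has received.
\<close>

definition item_messages ::
  "nat \<Rightarrow> (nat \<Rightarrow> nat \<Rightarrow> 'b set \<Rightarrow> (nat \<Rightarrow> 'b set) pmf) \<Rightarrow> nat \<Rightarrow> (nat \<Rightarrow> 'b set)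
    \<Rightarrow> (nat \<Rightarrow> nat \<Rightarrow> 'b set) pmf" where
  "item_messages k act r X = Pi_pmf {..<k} (\<lambda>_. {}) (\<lambda>i. act r i (X i))"

definition deliver :: "nat \<Rightarrow> (nat \<Rightarrow> nat \<Rightarrow> 'b set) \<Rightarrow> nat \<Rightarrow> 'b set" where
  "deliver k msg j = (if j < k then \<Union>i<k. msg i j else {})"

primrec item_run ::
  "nat \<Rightarrow> (nat \<Rightarrow> nat \<Rightarrow> 'b set \<Rightarrow> (nat \<Rightarrow> 'b set) pmf) \<Rightarrow> (nat \<Rightarrow> 'b set) \<Rightarrow> nat
    \<Rightarrow> (nat \<Rightarrow> 'b set) pmf" where
  "item_run k act X 0 = return_pmf X"
| "item_run k act X (Suc r) =
     bind_pmf (item_run k act X r) (\<lambda>Y. map_pmf (deliver k) (item_messages k act r Y))"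

definition messages_within :: "nat \<Rightarrow> nat \<Rightarrow> 'b set \<Rightarrow> (nat \<Rightarrow> nat \<Rightarrow> 'b set) \<Rightarrow> bool" where
  "messages_within k b U msg \<longleftrightarrow>
     (\<forall>i<k. \<forall>j<k. msg i j \<subseteq> U) \<and>
     (\<forall>j<k. (\<Sum>i<k. card (msg i j)) \<le> b) \<and>
     (\<forall>i<k. (\<Sum>j<k. card (msg i j)) \<le> b)"

definition encode_items :: "('b \<Rightarrow> nat) \<Rightarrow> 'b set \<Rightarrow> nat list" where
  "encode_items enc X = sorted_list_of_set (enc ` X)"

definition decode_items :: "('b \<Rightarrow> nat) \<Rightarrow> 'b set \<Rightarrow> nat list \<Rightarrow> 'b set" where
  "decode_items enc U l = {x \<in> U. enc x \<in> set l}"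

text \<open>The initial data are not encoded items; \<open>init\<close> converts those of a single machine.\<close>

definition encoded_program ::
  "nat \<Rightarrow> ('b \<Rightarrow> nat) \<Rightarrow> 'b set \<Rightarrow> (nat list \<Rightarrow> 'b set)
    \<Rightarrow> (nat \<Rightarrow> nat \<Rightarrow> 'b set \<Rightarrow> (nat \<Rightarrow> 'b set) pmf) \<Rightarrow> mpc_program" where
  "encoded_program k enc U init act r i data =
     map_pmf (\<lambda>msg j. encode_items enc (msg j))
       (act r i (if r = 0 then init (data i) else \<Union>i'<k. decode_items enc U (data i')))"

text \<open>Mirrors how \<open>encoded_program\<close> reads its data. In round 0 the data of
  machine \<open>j\<close> are a single message from itself.\<close>

definition decode_config ::
  "nat \<Rightarrow> ('b \<Rightarrow> nat) \<Rightarrow> 'b set \<Rightarrow> (nat list \<Rightarrow> 'b set) \<Rightarrow> nat \<Rightarrow> mpc_config \<Rightarrow> nat \<Rightarrow> 'b set" where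
  "decode_config k enc U init r C j =
     (if j < k then if r = 0 then init (C j j) else \<Union>i<k. decode_items enc U (C j i) else {})"

definition encode_messages ::
  "nat \<Rightarrow> ('b \<Rightarrow> nat) \<Rightarrow> (nat \<Rightarrow> nat \<Rightarrow> 'b set) \<Rightarrow> mpc_config" where
  "encode_messages k enc msg j i = (if i < k \<and> j < k then encode_items enc (msg i j) else [])"

lemma decode_encode_items:
  assumes "finite U" "inj_on enc U" "X \<subseteq> U"
  shows "decode_items enc U (encode_items enc X) = X"
  using assms finite_subset[OF assms(3,1)]
  by (auto simp: decode_items_def encode_items_def inj_on_def subset_iff)

lemma length_encode_items:
  assumes "finite U" "inj_on enc U" "X \<subseteq> U"
  shows "length (encode_items enc X) = card X"
  using card_image[OF inj_on_subset[OF assms(2,3)]] by (simp add: encode_items_def)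

lemma mpc_round_encoded_program:
  "mpc_round k (encoded_program k enc U init act) r C =
     map_pmf (encode_messages k enc) (item_messages k act r (decode_config k enc U init r C))"
proof -
  have "mpc_round k (encoded_program k enc U init act) r C =
    map_pmf (\<lambda>msg j i. if i < k \<and> j < k then msg i j else [])
      (Pi_pmf {..<k} (\<lambda>_. []) (\<lambda>i. map_pmf (\<lambda>msg j. encode_items enc (msg j))
        (act r i (decode_config k enc U init r C i))))"
    unfolding mpc_round_def encoded_program_def
    by (intro arg_cong[where f = "map_pmf _"] Pi_pmf_cong) (auto simp: decode_config_def)
  also have "\<dots> = map_pmf (encode_messages k enc)
      (item_messages k act r (decode_config k enc U init r C))"
    unfolding item_messages_def
    by (subst Pi_pmf_map[where dflt = "\<lambda>_. {}"])
       (auto simp: encode_items_def encode_messages_def map_pmf_comp fun_eq_iff intro!: map_pmf_cong)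
  finally show ?thesis .
qed

text \<open>The bound on messages is required only for those that can occur. It speaks of items
  alone, so it can be verified without encodings, and it supplies the inclusion in \<open>U\<close>
  under which decoding inverts encoding.\<close>

context
  fixes k b W :: nat and enc :: "'b \<Rightarrow> nat" and U :: "'b set"
    and init :: "nat list \<Rightarrow> 'b set"
    and act :: "nat \<Rightarrow> nat \<Rightarrow> 'b set \<Rightarrow> (nat \<Rightarrow> 'b set) pmf" and C0 :: mpc_config
  assumes U: "finite U" "inj_on enc U"
    and W: "\<And>x. x \<in> U \<Longrightarrow> enc x < W"
    and within: "\<And>r X msg. X \<in> set_pmf (item_run k act (decode_config k enc U init 0 C0) r) \<Longrightarrow>
          msg \<in> set_pmf (item_messages k act r X) \<Longrightarrow> messages_within k b U msg"
begin

lemma decode_encode_messages: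
  assumes "messages_within k b U msg"
  shows "decode_config k enc U init (Suc r) (encode_messages k enc msg) = deliver k msg"
proof
  fix j
  have "(\<Union>i<k. decode_items enc U (encode_messages k enc msg j i)) = (\<Union>i<k. msg i j)" if "j < k"
    using assms that by (intro SUP_cong) (auto simp: encode_messages_def messages_within_def decode_encode_items[OF U])
  then show "decode_config k enc U init (Suc r) (encode_messages k enc msg) j = deliver k msg j"
    by (simp add: decode_config_def deliver_def)
qed

lemma mpc_run_encoded_program:
  "map_pmf (decode_config k enc U init r) (mpc_run k (encoded_program k enc U init act) C0 r)
     = item_run k act (decode_config k enc U init 0 C0) r"
proof (induction r)
  case (Suc r)
  let ?P = "encoded_program k enc U init act" and ?X0 = "decode_config k enc U init 0 C0"
  let ?dec = "decode_config k enc U init"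
  have "map_pmf (?dec (Suc r)) (mpc_run k ?P C0 (Suc r)) =
    bind_pmf (mpc_run k ?P C0 r) (\<lambda>C. map_pmf (\<lambda>msg. ?dec (Suc r) (encode_messages k enc msg))
       (item_messages k act r (?dec r C)))"
    by (simp add: map_bind_pmf mpc_round_encoded_program map_pmf_comp)
  also have "\<dots> = bind_pmf (mpc_run k ?P C0 r)
      (\<lambda>C. map_pmf (deliver k) (item_messages k act r (?dec r C)))"
  proof (intro bind_pmf_cong map_pmf_cong refl decode_encode_messages)
    fix C msg assume "C \<in> set_pmf (mpc_run k ?P C0 r)" "msg \<in> set_pmf (item_messages k act r (?dec r C))"
    then show "messages_within k b U msg"
      by (intro within) (auto simp flip: Suc.IH)
  qed
  also have "\<dots> = bind_pmf (map_pmf (?dec r) (mpc_run k ?P C0 r))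
      (\<lambda>X. map_pmf (deliver k) (item_messages k act r X))"
    by (simp add: bind_map_pmf)
  finally show ?case by (simp add: Suc.IH)
qed simp

text \<open>Stated for \<open>Suc r\<close> because the initial configuration consists of raw vertex
  lists, not of encoded messages, and is bounded separately.\<close>

lemma mpc_within_encoded_program:
  assumes C: "C \<in> set_pmf (mpc_run k (encoded_program k enc U init act) C0 (Suc r))"
  shows "mpc_within k b W C"
proof -
  let ?P = "encoded_program k enc U init act"
  obtain C' msg where C': "C' \<in> set_pmf (mpc_run k ?P C0 r)"
    and msg: "msg \<in> set_pmf (item_messages k act r (decode_config k enc U init r C'))"
    and C_eq: "C = encode_messages k enc msg"
    using C by (auto simp: mpc_round_encoded_program)
  have "decode_config k enc U init r C' \<in> set_pmf (item_run k act (decode_config k enc U init 0 C0) r)"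
    using C' by (auto simp flip: mpc_run_encoded_program)
  then have *: "messages_within k b U msg" using msg by (rule within)
  have sub: "msg i j \<subseteq> U" if "i < k" "j < k" for i j
    using * that by (auto simp: messages_within_def)
  have "length (C j i) = card (msg i j)" if "i < k" "j < k" for i j
    using that sub[OF that] by (simp add: C_eq encode_messages_def length_encode_items[OF U])
  moreover have "x < W" if "i < k" "j < k" "x \<in> set (C j i)" for i j x
    using that sub[of i j] W finite_subset[OF sub U(1)]
    by (auto simp: C_eq encode_messages_def encode_items_def)
  ultimately show ?thesis
    using * by (simp add: mpc_within_def messages_within_def)
qed

end

section \<open>The program\<close>

text \<open>\<open>Edge\<close> and \<open>Sampled\<close> items stay on the machine of the edge;
  \<open>Chosen\<close>, \<open>Received\<close> and the flags live on machine 0.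
  \<open>Count\<close> carries its sender, since messages are merged as sets and equal counts would
  collapse. \<open>Bcast v c\<close> announces either a vertex \<open>v\<close>, with
  \<open>c = 0\<close>, or a number \<open>c\<close>, with \<open>v = 0\<close>.\<close>

datatype item =
    Edge "nat set"
  | Sampled "nat set"
  | Chosen "nat set"
  | Received "nat set"
  | Abort
  | Done
  | Count nat nat
  | Bcast nat nat

locale sampling_program =
  fixes n k d s L :: nat and mm :: "nat set \<Rightarrow> nat set set \<Rightarrow> nat set set"
begin

text \<open>Level 0 consists of the machines themselves, and everything above level \<open>L\<close>
  is the root at machine 0. In between, a node is hosted by the first machine of its block, shifted
  cyclically by \<open>v\<close> so that the trees of different items spread over the
  machines.\<close>

definition position :: "nat \<Rightarrow> nat \<Rightarrow> nat \<Rightarrow> nat" where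
  "position m v y = (if m = 0 then y else if m > L then 0 else (y * n ^ m + v) mod k)"

text \<open>Machine \<open>i\<close> may host several nodes of level \<open>m\<close>; for each
  child \<open>y\<close> of such a node whose block is nonempty, the item is passed on to the host
  of \<open>y\<close>.\<close>

definition route :: "nat \<Rightarrow> nat \<Rightarrow> item set \<Rightarrow> nat \<Rightarrow> item set" where
  "route m i H j = {x \<in> H. \<exists>v c y. x = Bcast v c \<and> y * n ^ (m - 1) < k \<and>
     position (m - 1) v y = j \<and> position m v (y div n) = i}"

definition count_sum :: "item set \<Rightarrow> nat" where
  "count_sum X = (\<Sum>p | Count (fst p) (snd p) \<in> X. snd p)"

definition running :: "item set \<Rightarrow> bool" where
  "running X \<longleftrightarrow> Abort \<notin> X \<and> Done \<notin> X"

definition stored :: "item set \<Rightarrow> item set" where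
  "stored X = {x \<in> X. \<forall>a b. x \<noteq> Count a b \<and> x \<noteq> Bcast a b}"

definition own_count :: "nat \<Rightarrow> item set \<Rightarrow> nat" where
  "own_count \<mu> X = card (if \<mu> = 1 then Sampled -` X else Edge -` X)"

text \<open>A run that has ended announces \<open>s + 1\<close>, which reads as too many edges; so
  the machines submit nothing although they do not know the flags.\<close>

definition broadcast :: "nat \<Rightarrow> item set \<Rightarrow> item set" where
  "broadcast \<mu> X =
     (if \<mu> = 2
      then (\<lambda>v. Bcast v 0) ` ({..<n} \<inter> \<Union>(Chosen -` X \<union> mm {..<n} (Received -` X)))
      else {Bcast 0 (if running X then count_sum X else s + 1)})"

definition total :: "item set \<Rightarrow> nat" where
  "total X = (THE c. Bcast 0 c \<in> X)"

text \<open>The abort is guarded by \<open>Done\<close> because a completed run announces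
  \<open>s + 1\<close> as well. Once the run has ended, \<open>Received\<close> is kept: after
  completion it holds the remaining edges, from which the last matching is computed.\<close>

definition update :: "nat \<Rightarrow> nat \<Rightarrow> item set \<Rightarrow> item set" where
  "update \<mu> i X =
     (if \<mu> = 1 then stored X \<union> (if i = 0 \<and> total X > s \<and> Done \<notin> X then {Abort} else {})
      else if \<mu> = 2 then
        (if i = 0 \<and> running X
         then (stored X - range Edge - range Received) \<union> Chosen ` mm {..<n} (Received -` X)
         else stored X - range Edge) \<union> Edge ` {e. Edge e \<in> X \<and> (\<forall>v\<in>e. \<forall>c. Bcast v c \<notin> X)}
      else stored X \<union> (if i = 0 \<and> total X \<le> s then {Done} else {}))"

definition submit :: "nat \<Rightarrow> item set \<Rightarrow> item set" where
  "submit \<mu> X =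
     (if \<mu> \<noteq> 2 \<and> total X \<le> s
      then Received ` (if \<mu> = 1 then Sampled -` X else Edge -` X) else {})"

definition conclude :: "nat \<Rightarrow> nat \<Rightarrow> item set \<Rightarrow> (nat \<Rightarrow> item set) pmf" where
  "conclude \<mu> i X =
     (if \<mu> = 0
      then map_pmf (\<lambda>T j. if j = i then (stored X - range Sampled) \<union> Sampled ` T else {})
        (sample_edges (min 1 (real s / (5 * real (total X) * real d))) (Edge -` X))
      else return_pmf (\<lambda>j. (if j = i then update \<mu> i X else {}) \<union>
        (if j = 0 then submit \<mu> X else {})))"

text \<open>
  A superstep takes \<open>2 L + 2\<close> rounds: the local counts are summed up along the tree in which the
  parent of machine \<open>i\<close> is \<open>i div n\<close>; machine \<open>0\<close> broadcasts; all machines update their data.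
  A pass through the loop consists of four supersteps, numbered by \<open>\<mu>\<close>: sampling, collecting the
  sample on machine \<open>0\<close>, removing the edges that are hit, and collecting the remaining edges.

  Broadcasting \<open>n\<close> items with fan-out \<open>n\<close> would overload machine \<open>0\<close>; so the items are scattered
  first, and each item \<open>Bcast v c\<close> runs through a tree of its own: on level \<open>m\<close>, the node
  for the block \<open>{y n\<^sup>m ..< (y + 1) n\<^sup>m}\<close> of machines is hosted by machine \<open>position m v y\<close>.
\<close>

definition act :: "nat \<Rightarrow> nat \<Rightarrow> item set \<Rightarrow> (nat \<Rightarrow> item set) pmf" where
  "act r i X =
     (let \<rho> = r mod (2 * L + 2); \<mu> = r div (2 * L + 2) mod 4
      in if \<rho> < L then
           return_pmf (\<lambda>j. (if j = i then stored X else {}) \<union>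
             (if j = i div n then {Count i (if \<rho> = 0 then own_count \<mu> X else count_sum X)} else {}))
         else if \<rho> \<le> 2 * L then
           return_pmf (\<lambda>j. (if j = i then stored X else {}) \<union>
             route (2 * L + 1 - \<rho>) i
               (if \<rho> = L then if i = 0 then broadcast \<mu> X else {} else X) j)
         else conclude \<mu> i X)"

definition result :: "item set \<Rightarrow> nat set set option" where
  "result X =
     (if Done \<in> X
      then Some (Chosen -` X \<union> mm (unmatched {..<n} (Chosen -` X)) (Received -` X)) else None)"

end

lemma mult_add_div_mod:
  fixes \<rho> q a :: nat
  assumes "\<rho> < q"
  shows "(q * a + \<rho>) mod q = \<rho>" "(q * a + \<rho>) div q = a"
  using assms by simp_all

subsection \<open>Global states\<close>

datatype status = Active | Aborted | Completed

text \<open>Together with the fixed placement \<open>loc\<close> of the edges, this determines the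
  data of every machine at the beginning of a superstep.\<close>

datatype global_state =
  Global (status: status) (chosen: "nat set set") (received: "nat set set")
    (current: "nat set set") (sampled: "nat set set")

locale sampling_simulation = sampling_program +
  fixes E :: "nat set set" and loc :: "nat \<Rightarrow> nat set set"
  assumes n: "n \<ge> 1" and k: "k \<ge> 1" "k \<le> n ^ L" and L: "L \<ge> 1" and d: "d \<ge> 1"
    and E: "uniform_hypergraph d {..<n} E"
    and mm: "\<And>V F. uniform_hypergraph d V F \<Longrightarrow> maximal_matching F (mm V F)"
    and loc_disj: "disjoint_family_on loc {..<k}" and loc_Un: "(\<Union>i<k. loc i) = E"
    and loc_card: "\<And>i. i < k \<Longrightarrow> card (loc i) \<le> s"
begin

definition store :: "global_state \<Rightarrow> nat \<Rightarrow> item set" where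
  "store g i =
     Edge ` (current g \<inter> loc i) \<union> Sampled ` (sampled g \<inter> loc i) \<union>
     (if i = 0 then Chosen ` chosen g \<union> Received ` received g \<union>
        (if status g = Aborted then {Abort} else {}) \<union> (if status g = Completed then {Done} else {})
      else {})"

definition local_count :: "nat \<Rightarrow> global_state \<Rightarrow> nat \<Rightarrow> nat" where
  "local_count \<mu> g i = card ((if \<mu> = 1 then sampled g else current g) \<inter> loc i)"

text \<open>The value at node \<open>i\<close> on level \<open>u\<close> of the summation tree,
  whose block is the set of machines \<open>j\<close> with \<open>j div n ^ u = i\<close>.\<close>

definition partial_count :: "nat \<Rightarrow> global_state \<Rightarrow> nat \<Rightarrow> nat \<Rightarrow> nat" where
  "partial_count \<mu> g u i = (\<Sum>j | j < k \<and> j div n ^ u = i. local_count \<mu> g j)"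

definition announced :: "nat \<Rightarrow> global_state \<Rightarrow> nat" where
  "announced \<mu> g = (if status g = Active then card (if \<mu> = 1 then sampled g else current g) else s + 1)"

definition hit :: "global_state \<Rightarrow> nat set" where
  "hit g = \<Union>(chosen g \<union> mm {..<n} (received g))"

definition announcement :: "nat \<Rightarrow> global_state \<Rightarrow> item set" where
  "announcement \<mu> g = (if \<mu> = 2 then (\<lambda>v. Bcast v 0) ` hit g else {Bcast 0 (announced \<mu> g)})"

definition held :: "nat \<Rightarrow> item set \<Rightarrow> nat \<Rightarrow> item set" where
  "held m B i = {x \<in> B. \<exists>v c y. x = Bcast v c \<and> y * n ^ m < k \<and> position m v y = i}"

text \<open>What has just arrived at the beginning of round \<rho>: counts from the children for
  \<open>1 \<le> \<rho> \<le> L\<close>, afterwards items on their way down, at level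
  \<open>L\<close> for \<open>\<rho> = L + 1\<close> and at the machines themselves for
  \<open>\<rho> = 2 * L + 1\<close>.\<close>

definition transit :: "nat \<Rightarrow> global_state \<Rightarrow> nat \<Rightarrow> nat \<Rightarrow> item set" where
  "transit \<mu> g \<rho> i =
     (if \<rho> = 0 then {}
      else if \<rho> \<le> L then {Count j (partial_count \<mu> g (\<rho> - 1) j) | j. j < k \<and> j div n = i}
      else held (2 * L + 1 - \<rho>) (announcement \<mu> g) i)"

definition config :: "nat \<Rightarrow> global_state \<Rightarrow> nat \<Rightarrow> nat \<Rightarrow> item set" where
  "config \<mu> g \<rho> i = (if i < k then store g i \<union> transit \<mu> g \<rho> i else {})"

definition advance :: "nat \<Rightarrow> global_state \<Rightarrow> global_state" where
  "advance \<mu> g =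
     (case g of Global st M R F T \<Rightarrow>
        if \<mu> = 1 then
          if announced \<mu> g \<le> s then Global st M (R \<union> T) F T
          else Global (if st = Completed then Completed else Aborted) M R F T
        else if \<mu> = 2 then
          let F' = {e \<in> F. e \<inter> hit g = {}}
          in if st = Active then Global st (M \<union> mm {..<n} R) {} F' T else Global st M R F' T
        else
          if announced \<mu> g \<le> s then Global Completed M (R \<union> F) F T else g)"

definition superstep :: "nat \<Rightarrow> global_state \<Rightarrow> global_state pmf" where
  "superstep \<mu> g =
     (if \<mu> = 0
      then map_pmf (\<lambda>T. Global (status g) (chosen g) (received g) (current g) T)
        (sample_edges (min 1 (real s / (5 * real (announced \<mu> g) * real d))) (current g))
      else return_pmf (advance \<mu> g))"

primrec global_run :: "nat \<Rightarrow> global_state pmf" where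
  "global_run 0 = return_pmf (Global Active {} {} E {})"
| "global_run (Suc a) = bind_pmf (global_run a) (superstep (a mod 4))"

definition untouched :: "nat set set \<Rightarrow> nat set set" where
  "untouched M = {e \<in> E. e \<inter> \<Union>M = {}}"

text \<open>The invariant before superstep \<mu>. Its first half bounds sizes and is needed in every
  state, since messages go on after the run has ended. The second half concerns a run in progress,
  where \<open>received\<close> is filled only between the collection of a sample and its
  matching.\<close>

definition sound :: "nat \<Rightarrow> global_state \<Rightarrow> bool" where
  "sound \<mu> g \<longleftrightarrow>
     current g \<subseteq> E \<and> sampled g \<subseteq> E \<and> received g \<subseteq> E \<and> card (received g) \<le> s \<and>
     matching E (chosen g) \<and>
     (status g = Active \<longrightarrow>
        current g = untouched (chosen g) \<and>
        (\<mu> \<noteq> 2 \<longrightarrow> received g = {}) \<and>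
        (\<mu> = 1 \<longrightarrow> sampled g \<subseteq> current g) \<and>
        (\<mu> = 2 \<longrightarrow> received g \<subseteq> current g))"

lemma E_finite: "finite E"
  using E by (rule uniform_hypergraph_finite)

lemma E_sub: "e \<in> E \<Longrightarrow> e \<subseteq> {..<n}"
  using E by (auto simp: uniform_hypergraph_def)

lemma subE_finite: "F \<subseteq> E \<Longrightarrow> finite F"
  using E_finite finite_subset by blast

lemma mm_sub: "F \<subseteq> E \<Longrightarrow> maximal_matching F (mm {..<n} F)"
  using mm uniform_hypergraph_subset[OF E] by blast

lemma mm_subE: "F \<subseteq> E \<Longrightarrow> mm {..<n} F \<subseteq> F"
  using mm_sub[of F] by (auto simp: maximal_matching_def matching_def)

lemma loc_sub: "i < k \<Longrightarrow> loc i \<subseteq> E"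
  using loc_Un by auto

lemma loc_split: "F \<subseteq> E \<Longrightarrow> (\<Union>i<k. F \<inter> loc i) = F"
  using loc_Un by auto

lemma sum_card_loc: "F \<subseteq> E \<Longrightarrow> (\<Sum>i<k. card (F \<inter> loc i)) = card F"
proof -
  assume F: "F \<subseteq> E"
  have "card F = card (\<Union>i<k. F \<inter> loc i)" using loc_split[OF F] by simp
  also have "\<dots> = (\<Sum>i<k. card (F \<inter> loc i))"
    using subE_finite[OF F] loc_disj
    by (intro card_UN_disjoint') (auto simp: disjoint_family_on_def)
  finally show ?thesis by simp
qed

lemma sound_init: "sound 0 (Global Active {} {} E {})"
  by (auto simp: sound_def matching_def untouched_def)

lemma hit_sub: "sound \<mu> g \<Longrightarrow> hit g \<subseteq> {..<n}"
  using E_sub mm_subE[of "received g"] by (fastforce simp: sound_def hit_def matching_def)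

lemma sound_superstep:
  assumes g: "sound \<mu> g" and \<mu>: "\<mu> < 4" and g': "g' \<in> set_pmf (superstep \<mu> g)"
  shows "sound (Suc \<mu> mod 4) g'"
proof -
  obtain st M R F T where geq: "g = Global st M R F T" by (cases g)
  have F: "F \<subseteq> E" and T: "T \<subseteq> E" and R: "R \<subseteq> E" "card R \<le> s" and M: "matching E M"
    using g by (auto simp: sound_def geq)
  have act: "F = untouched M" "\<mu> \<noteq> 2 \<Longrightarrow> R = {}" "\<mu> = 1 \<Longrightarrow> T \<subseteq> F" "\<mu> = 2 \<Longrightarrow> R \<subseteq> F"
    if "st = Active" using g that by (auto simp: sound_def geq)
  have ann: "st = Active" if "announced \<mu> g \<le> s"
    using that by (auto simp: announced_def geq split: if_splits)
  consider "\<mu> = 0" | "\<mu> = 1" | "\<mu> = 2" | "\<mu> = 3" using \<mu> by linarith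
  then show ?thesis
  proof cases
    case 1
    then obtain T' where T': "g' = Global st M R F T'" "T' \<subseteq> F"
      using g' set_sample_edges_subset[OF subE_finite[OF F]] by (auto simp: superstep_def geq)
    have "T' \<subseteq> E" using T'(2) F by blast
    then show ?thesis using 1 F T'(2) R M act(1,2) by (cases st) (simp_all add: sound_def T'(1))
  next
    case 2
    show ?thesis
    proof (cases "announced \<mu> g \<le> s")
      case True
      note st = ann[OF True]
      have cT: "card T \<le> s" using True 2 st by (simp add: announced_def geq)
      have R: "R = {}" using act(2)[OF st] 2 by simp
      have "g' = Global st M T F T" using g' 2 True R by (simp add: superstep_def advance_def geq)
      moreover have "F = untouched M" "T \<subseteq> F" using act(1,3)[OF st] 2 by auto
      ultimately show ?thesis using 2 F T M cT by (simp add: sound_def)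
    next
      case False
      then have "g' = Global (if st = Completed then Completed else Aborted) M R F T"
        using g' 2 by (simp add: superstep_def advance_def geq)
      then show ?thesis using F T R M by (simp add: sound_def)
    qed
  next
    case 3
    have F': "{e \<in> F. e \<inter> hit g = {}} \<subseteq> E" using F by auto
    show ?thesis
    proof (cases "st = Active")
      case True
      have "{e \<in> F. e \<inter> hit g = {}} = untouched (M \<union> mm {..<n} R)"
        using act(1)[OF True] by (auto simp: untouched_def hit_def geq)
      \<comment> \<open>The received edges lie in \<open>F\<close>, which is untouched by
        \<open>M\<close>, so a matching among them extends \<open>M\<close>.\<close>
      moreover have "matching E (M \<union> mm {..<n} R)"
        using mm_sub[OF R(1)] act(4)[OF True 3] mm_subE[OF R(1)]
        by (intro matching_Un[OF M subset_refl])
          (auto simp: maximal_matching_def matching_def act(1)[OF True] untouched_def)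
      moreover have "g' = Global Active (M \<union> mm {..<n} R) {} {e \<in> F. e \<inter> hit g = {}} T"
        using g' 3 True by (simp add: superstep_def advance_def geq)
      ultimately show ?thesis using 3 T F' by (simp add: sound_def)
    next
      case False
      then have "g' = Global st M R {e \<in> F. e \<inter> hit g = {}} T"
        using g' 3 by (simp add: superstep_def advance_def geq)
      then show ?thesis using False T F' R M by (simp add: sound_def)
    qed
  next
    case 4
    show ?thesis
    proof (cases "announced \<mu> g \<le> s")
      case True
      note st = ann[OF True]
      have cF: "card F \<le> s" using True 4 st by (simp add: announced_def geq)
      have "R = {}" using act(2)[OF st] 4 by simp
      then have "g' = Global Completed M F F T"
        using g' 4 True by (simp add: superstep_def advance_def geq)
      then show ?thesis using F T M cF by (simp add: sound_def)
    next
      case False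
      then have "g' = g" using g' 4 by (simp add: superstep_def advance_def geq)
      then show ?thesis using g 4 by (simp add: sound_def)
    qed
  qed
qed

lemma sound_global_run: "g \<in> set_pmf (global_run a) \<Longrightarrow> sound (a mod 4) g"
proof (induction a arbitrary: g)
  case (Suc a)
  then obtain g0 where "g0 \<in> set_pmf (global_run a)" "g \<in> set_pmf (superstep (a mod 4) g0)"
    by auto
  then have "sound (Suc (a mod 4) mod 4) g" using sound_superstep[OF Suc.IH] by simp
  then show ?case by (simp add: mod_Suc_eq)
qed (simp add: sound_init)

subsection \<open>Correctness of a superstep\<close>

lemma transit_sub: "transit \<mu> g \<rho> i \<subseteq> range (case_prod Count) \<union> range (case_prod Bcast)"
  by (auto simp: transit_def held_def)

lemma transit_notin:
  "Edge e \<notin> transit \<mu> g \<rho> i" "Sampled e \<notin> transit \<mu> g \<rho> i" "Chosen e \<notin> transit \<mu> g \<rho> i"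
  "Received e \<notin> transit \<mu> g \<rho> i" "Abort \<notin> transit \<mu> g \<rho> i" "Done \<notin> transit \<mu> g \<rho> i"
  using transit_sub[of \<mu> g \<rho> i] by auto

lemma store_notin: "Count a b \<notin> store g i" "Bcast a b \<notin> store g i"
  by (auto simp: store_def)

lemma config_simps:
  assumes "i < k"
  shows "stored (config \<mu> g \<rho> i) = store g i"
    and "Edge -` config \<mu> g \<rho> i = current g \<inter> loc i"
    and "Sampled -` config \<mu> g \<rho> i = sampled g \<inter> loc i"
    and "Chosen -` config \<mu> g \<rho> 0 = chosen g"
    and "Received -` config \<mu> g \<rho> 0 = received g"
    and "Abort \<in> config \<mu> g \<rho> 0 \<longleftrightarrow> status g = Aborted"
    and "Done \<in> config \<mu> g \<rho> 0 \<longleftrightarrow> status g = Completed"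
    and "Count a b \<in> config \<mu> g \<rho> i \<longleftrightarrow> Count a b \<in> transit \<mu> g \<rho> i"
    and "Bcast a b \<in> config \<mu> g \<rho> i \<longleftrightarrow> Bcast a b \<in> transit \<mu> g \<rho> i"
proof -
  show "stored (config \<mu> g \<rho> i) = store g i"
    using assms transit_sub[of \<mu> g \<rho> i] by (auto simp: stored_def config_def store_notin)
qed (use assms k in \<open>auto simp: config_def store_def transit_notin\<close>)

lemma running_config: "running (config \<mu> g \<rho> 0) \<longleftrightarrow> status g = Active"
  using k by (cases "status g") (auto simp: running_def config_simps(6,7)[of 0])

section \<open>The summation tree\<close>

lemma partial_count_0: "i < k \<Longrightarrow> partial_count \<mu> g 0 i = local_count \<mu> g i"
proof -
  assume "i < k"
  then have "{j. j < k \<and> j = i} = {i}" by auto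
  then show ?thesis by (simp add: partial_count_def)
qed

text \<open>A block of level \<open>Suc u\<close> splits into the blocks of its children, because
  \<open>x div n ^ Suc u = x div n ^ u div n\<close>.\<close>

lemma partial_count_Suc:
  "partial_count \<mu> g (Suc u) i = (\<Sum>j | j < k \<and> j div n = i. partial_count \<mu> g u j)"
proof -
  have less: "x div n ^ u < k" if "x < k" for x
    using that le_less_trans[OF div_le_dividend] by blast
  have "(\<Sum>j | j < k \<and> j div n = i. partial_count \<mu> g u j) =
    (\<Sum>(j, x)\<in>(SIGMA j:{j. j < k \<and> j div n = i}. {x. x < k \<and> x div n ^ u = j}). local_count \<mu> g x)"
    unfolding partial_count_def by (subst sum.Sigma) auto
  also have "\<dots> = (\<Sum>x | x < k \<and> x div n ^ Suc u = i. local_count \<mu> g x)"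
  proof (rule sum.reindex_bij_witness[of _ "\<lambda>x. (x div n ^ u, x)" snd], goal_cases)
    case (4 x)
    then show ?case
      using less by (auto simp: div_mult2_eq[symmetric] mult.commute)
  qed (auto simp: div_mult2_eq[symmetric] mult.commute)
  finally show ?thesis by (simp add: partial_count_def)
qed

text \<open>Since \<open>k \<le> n ^ L\<close>, the block of node 0 on level \<open>L\<close>
  contains all machines.\<close>

lemma partial_count_L:
  assumes "sound \<mu> g"
  shows "partial_count \<mu> g L 0 = card (if \<mu> = 1 then sampled g else current g)"
proof -
  have "{j. j < k \<and> j div n ^ L = 0} = {..<k}"
    using k by (auto intro: less_le_trans)
  moreover have "(if \<mu> = 1 then sampled g else current g) \<subseteq> E" using assms by (auto simp: sound_def)
  ultimately show ?thesis
    using sum_card_loc by (simp add: partial_count_def local_count_def)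
qed

lemma partial_count_le:
  assumes "sound \<mu> g"
  shows "partial_count \<mu> g u i \<le> card E"
proof -
  have F: "(if \<mu> = 1 then sampled g else current g) \<subseteq> E" using assms by (auto simp: sound_def)
  have "partial_count \<mu> g u i \<le> (\<Sum>j<k. local_count \<mu> g j)"
    unfolding partial_count_def by (rule sum_mono2) auto
  also have "\<dots> = card (if \<mu> = 1 then sampled g else current g)"
    unfolding local_count_def by (rule sum_card_loc[OF F])
  also have "\<dots> \<le> card E" using F E_finite by (rule card_mono[rotated])
  finally show ?thesis .
qed

lemma count_sum_config:
  assumes "i < k" "0 < \<rho>" "\<rho> \<le> L"
  shows "count_sum (config \<mu> g \<rho> i) = partial_count \<mu> g \<rho> i"
proof -
  obtain u where u: "\<rho> = Suc u" using assms(2) by (cases \<rho>) auto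
  have "{p. Count (fst p) (snd p) \<in> config \<mu> g \<rho> i} =
      (\<lambda>j. (j, partial_count \<mu> g u j)) ` {j. j < k \<and> j div n = i}"
    using assms by (auto simp: config_simps transit_def u)
  then show ?thesis
    by (simp add: count_sum_def u partial_count_Suc sum.reindex inj_on_def)
qed

section \<open>The broadcast trees\<close>

lemma announcement_sub: "announcement \<mu> g \<subseteq> range (case_prod Bcast)"
  by (auto simp: announcement_def)

lemma broadcast_config:
  assumes g: "sound \<mu> g"
  shows "broadcast \<mu> (config \<mu> g L 0) = announcement \<mu> g"
proof -
  have k0: "0 < k" using k by simp
  have "{..<n} \<inter> hit g = hit g" using hit_sub[OF g] by auto
  then show ?thesis
    using L count_sum_config[OF k0, of L \<mu> g] partial_count_L[OF g]
    by (auto simp: broadcast_def announcement_def announced_def running_config hit_def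
        config_simps[OF k0])
qed

text \<open>As \<open>k \<le> n ^ Suc L\<close>, only the block of \<open>y = 0\<close> is nonempty
  on this level; it is the root, from which the items are scattered.\<close>

lemma held_top: "held (Suc L) B i = (if i = 0 then B \<inter> range (case_prod Bcast) else {})"
proof -
  have "k \<le> n ^ Suc L" using k(2) n by (simp add: le_trans[OF k(2)])
  then have "y * n ^ Suc L < k \<longleftrightarrow> y = 0" for y
    using k(1) by (cases y) (auto simp del: power_Suc)
  then show ?thesis by (auto simp: held_def position_def simp del: power_Suc)
qed

lemma held_bot: "i < k \<Longrightarrow> held 0 B i = B \<inter> range (case_prod Bcast)"
  by (auto simp: held_def position_def)

text \<open>The block of the parent begins no later than that of the child, so every nonempty block
  has a nonempty parent and no item is lost on the way down.\<close>

lemma div_block: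
  assumes "0 < m" "y * n ^ (m - 1) < k"
  shows "y div n * n ^ m < k"
proof -
  have "y div n * n ^ m = (y div n * n) * n ^ (m - 1)" using assms(1) by (cases m) auto
  also have "\<dots> \<le> y * n ^ (m - 1)" by (intro mult_right_mono) auto
  finally show ?thesis using assms(2) by simp
qed

lemma route_held:
  assumes "0 < m"
  shows "route m i (held m B i) j = route m i B j"
  using div_block[OF assms] by (auto simp: route_def held_def)

lemma route_cong:
  "(\<And>a b. Bcast a b \<in> H \<longleftrightarrow> Bcast a b \<in> H') \<Longrightarrow> route m i H j = route m i H' j"
  by (auto simp: route_def)

lemma position_less: "0 < m \<Longrightarrow> position m v y < k"
  using k by (simp add: position_def)

text \<open>Each node of level \<open>m - 1\<close> has exactly one parent, hosted by an actual
  machine by \<open>position_less\<close>; so the messages of all senders make up the next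
  level.\<close>

lemma Union_route:
  assumes "0 < m"
  shows "(\<Union>i<k. route m i B j) = held (m - 1) B j"
  using position_less[OF assms] by (auto simp: route_def held_def)

end

context sampling_simulation
begin

section \<open>The rounds of a superstep\<close>

definition count_message :: "nat \<Rightarrow> global_state \<Rightarrow> nat \<Rightarrow> nat \<Rightarrow> nat \<Rightarrow> item set" where
  "count_message \<mu> g \<rho> i j =
     (if j = i then store g i else {}) \<union> (if j = i div n then {Count i (partial_count \<mu> g \<rho> i)} else {})"

definition broadcast_message :: "nat \<Rightarrow> global_state \<Rightarrow> nat \<Rightarrow> nat \<Rightarrow> nat \<Rightarrow> item set" where
  "broadcast_message \<mu> g \<rho> i j =
     (if j = i then store g i else {}) \<union> route (2 * L + 1 - \<rho>) i (announcement \<mu> g) j"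

definition round_message :: "nat \<Rightarrow> global_state \<Rightarrow> nat \<Rightarrow> nat \<Rightarrow> nat \<Rightarrow> item set" where
  "round_message \<mu> g \<rho> i = (if \<rho> < L then count_message \<mu> g \<rho> i else broadcast_message \<mu> g \<rho> i)"

lemma act_round:
  assumes g: "sound \<mu> g" and i: "i < k" and \<mu>: "\<mu> < 4" "a mod 4 = \<mu>" and \<rho>: "\<rho> \<le> 2 * L"
  shows "act ((2 * L + 2) * a + \<rho>) i (config \<mu> g \<rho> i) = return_pmf (round_message \<mu> g \<rho> i)"
proof -
  have mods: "((2 * L + 2) * a + \<rho>) mod (2 * L + 2) = \<rho>"
     "((2 * L + 2) * a + \<rho>) div (2 * L + 2) mod 4 = \<mu>"
    using mult_add_div_mod[of \<rho> "2 * L + 2" a] \<rho> \<mu> by simp_all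
  show ?thesis
  proof (cases "\<rho> < L")
    case True
    have count: "(if \<rho> = 0 then own_count \<mu> (config \<mu> g \<rho> i) else count_sum (config \<mu> g \<rho> i))
        = partial_count \<mu> g \<rho> i"
      using True i by (auto simp: own_count_def config_simps partial_count_0 local_count_def count_sum_config)
    have "act ((2 * L + 2) * a + \<rho>) i (config \<mu> g \<rho> i) =
        return_pmf (\<lambda>j. (if j = i then stored (config \<mu> g \<rho> i) else {}) \<union>
          (if j = i div n then {Count i (if \<rho> = 0 then own_count \<mu> (config \<mu> g \<rho> i)
             else count_sum (config \<mu> g \<rho> i))} else {}))"
      unfolding act_def Let_def mods if_P[OF True] ..
    also have "\<dots> = return_pmf (round_message \<mu> g \<rho> i)"
      unfolding count config_simps(1)[OF i] round_message_def if_P[OF True] count_message_def[abs_def] ..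
    finally show ?thesis .
  next
    case False
    define m where "m = 2 * L + 1 - \<rho>"
    have m: "0 < m" using \<rho> by (simp add: m_def)
    have "route m i (if \<rho> = L then if i = 0 then broadcast \<mu> (config \<mu> g \<rho> i) else {}
        else config \<mu> g \<rho> i) j = route m i (held m (announcement \<mu> g) i) j" for j
    proof (cases "\<rho> = L")
      case True
      then have "m = Suc L" by (simp add: m_def)
      then show ?thesis using True announcement_sub[of \<mu> g] broadcast_config[OF g]
        by (auto simp: held_top Int_absorb2)
    next
      case neq: False
      then have "\<rho> \<noteq> 0" "\<not> \<rho> \<le> L" using False by auto
      then have "route m i (config \<mu> g \<rho> i) j = route m i (held m (announcement \<mu> g) i) j"
        by (intro route_cong) (simp add: config_simps[OF i] transit_def m_def)
      then show ?thesis using neq by simp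
    qed
    then have "(\<lambda>j. (if j = i then stored (config \<mu> g \<rho> i) else {}) \<union>
        route m i (if \<rho> = L then if i = 0 then broadcast \<mu> (config \<mu> g \<rho> i) else {}
          else config \<mu> g \<rho> i) j) = round_message \<mu> g \<rho> i"
      unfolding config_simps(1)[OF i] round_message_def if_not_P[OF False] broadcast_message_def[abs_def]
      using route_held[OF m] by (simp only: m_def)
    then show ?thesis
      unfolding act_def Let_def mods if_not_P[OF False] if_P[OF \<rho>] m_def by simp
  qed
qed

lemma item_messages_round:
  assumes "sound \<mu> g" "\<mu> < 4" "a mod 4 = \<mu>" "\<rho> \<le> 2 * L"
  shows "item_messages k act ((2 * L + 2) * a + \<rho>) (config \<mu> g \<rho>) =
    return_pmf (\<lambda>i. if i < k then round_message \<mu> g \<rho> i else (\<lambda>_. {}))"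
proof -
  have "item_messages k act ((2 * L + 2) * a + \<rho>) (config \<mu> g \<rho>) =
     Pi_pmf {..<k} (\<lambda>_. {}) (\<lambda>i. return_pmf (round_message \<mu> g \<rho> i))"
    unfolding item_messages_def by (intro Pi_pmf_cong refl act_round) (use assms in auto)
  then show ?thesis by simp
qed

lemma deliver_round:
  assumes "\<rho> \<le> 2 * L"
  shows "deliver k (\<lambda>i. if i < k then round_message \<mu> g \<rho> i else (\<lambda>_. {})) = config \<mu> g (Suc \<rho>)"
proof
  fix j
  show "deliver k (\<lambda>i. if i < k then round_message \<mu> g \<rho> i else (\<lambda>_. {})) j = config \<mu> g (Suc \<rho>) j"
  proof (cases "j < k")
    case True
    have eq: "deliver k (\<lambda>i. if i < k then round_message \<mu> g \<rho> i else (\<lambda>_. {})) j =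
        (\<Union>i<k. round_message \<mu> g \<rho> i j)"
      using True by (auto simp: deliver_def)
    show ?thesis
    proof (cases "\<rho> < L")
      case \<rho>: True
      have "(\<Union>i<k. round_message \<mu> g \<rho> i j) = store g j \<union> transit \<mu> g (Suc \<rho>) j"
        using True \<rho> by (auto simp: round_message_def count_message_def transit_def split: if_splits)
      then show ?thesis using True eq by (simp add: config_def)
    next
      case \<rho>: False
      have "(\<Union>i<k. round_message \<mu> g \<rho> i j) =
          store g j \<union> (\<Union>i<k. route (2 * L + 1 - \<rho>) i (announcement \<mu> g) j)"
        using True \<rho> by (auto simp: round_message_def broadcast_message_def split: if_splits)
      also have "(\<Union>i<k. route (2 * L + 1 - \<rho>) i (announcement \<mu> g) j) = transit \<mu> g (Suc \<rho>) j"
        using assms \<rho> by (subst Union_route) (auto simp: transit_def)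
      finally show ?thesis using True eq by (simp add: config_def)
    qed
  qed (simp add: deliver_def config_def)
qed

text \<open>
  The state after the last round of a superstep, except that the edges submitted to machine \<open>0\<close> are
  missing; \<open>T\<close> is the new sample.
\<close>

definition settle :: "nat \<Rightarrow> global_state \<Rightarrow> nat set set \<Rightarrow> global_state" where
  "settle \<mu> g T =
     (if \<mu> = 0 then Global (status g) (chosen g) (received g) (current g) T
      else Global (status (advance \<mu> g)) (chosen (advance \<mu> g))
        (if \<mu> = 2 then received (advance \<mu> g) else received g)
        (current (advance \<mu> g)) (sampled (advance \<mu> g)))"

definition submitted :: "nat \<Rightarrow> global_state \<Rightarrow> nat set set" where
  "submitted \<mu> g =
     (if (\<mu> = 1 \<or> \<mu> = 3) \<and> announced \<mu> g \<le> s then if \<mu> = 1 then sampled g else current g else {})"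

definition final_message :: "nat \<Rightarrow> global_state \<Rightarrow> nat set set \<Rightarrow> nat \<Rightarrow> nat \<Rightarrow> item set" where
  "final_message \<mu> g T i j =
     (if j = i then store (settle \<mu> g T) i else {}) \<union>
     (if j = 0 then Received ` (submitted \<mu> g \<inter> loc i) else {})"

lemma transit_bot: "i < k \<Longrightarrow> transit \<mu> g (2 * L + 1) i = announcement \<mu> g"
  using announcement_sub[of \<mu> g] by (auto simp: transit_def held_bot)

lemma total_config:
  assumes "i < k" "\<mu> \<noteq> 2"
  shows "total (config \<mu> g (2 * L + 1) i) = announced \<mu> g"
  unfolding total_def config_simps(9)[OF assms(1)] transit_bot[OF assms(1)]
  using assms(2) by (simp add: announcement_def)

lemma announced_le_Active: "announced \<mu> g \<le> s \<Longrightarrow> status g = Active"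
  by (simp add: announced_def split: if_splits)

lemma settle_simps:
  "settle 1 g T = (if announced 1 g \<le> s then g
     else Global (if status g = Completed then Completed else Aborted)
       (chosen g) (received g) (current g) (sampled g))"
  "settle 2 g T =
     (if status g = Active
      then Global Active (chosen g \<union> mm {..<n} (received g)) {} {e \<in> current g. e \<inter> hit g = {}} (sampled g)
      else Global (status g) (chosen g) (received g) {e \<in> current g. e \<inter> hit g = {}} (sampled g))"
  "settle 3 g T =
     (if announced 3 g \<le> s then Global Completed (chosen g) (received g) (current g) (sampled g) else g)"
  by (cases g; simp add: settle_def advance_def Let_def)+

lemma submit_config:
  assumes i: "i < k" and \<mu>: "\<mu> < 4" "\<mu> \<noteq> 0"
  shows "submit \<mu> (config \<mu> g (2 * L + 1) i) = Received ` (submitted \<mu> g \<inter> loc i)"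
proof -
  consider "\<mu> = 1" | "\<mu> = 2" | "\<mu> = 3" using \<mu> by linarith
  then show ?thesis
    unfolding submit_def submitted_def config_simps(2,3)[OF i]
    by cases (simp_all only: total_config[OF i], simp_all)
qed

lemma update_config:
  assumes i: "i < k" and \<mu>: "\<mu> < 4" "\<mu> \<noteq> 0"
  shows "update \<mu> i (config \<mu> g (2 * L + 1) i) = store (settle \<mu> g T) i"
proof -
  have k0: "0 < k" using k by simp
  consider "\<mu> = 1" | "\<mu> = 2" | "\<mu> = 3" using \<mu> by linarith
  then show ?thesis
  proof cases
    case 1
    then have ne: "\<mu> \<noteq> 2" by simp
    have "update \<mu> i (config \<mu> g (2 * L + 1) i) =
        store g i \<union> (if i = 0 \<and> announced 1 g > s \<and> status g \<noteq> Completed then {Abort} else {})"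
      unfolding update_def total_config[OF i ne] config_simps(1)[OF i]
      using config_simps(7)[OF k0] 1 by auto
    also have "\<dots> = store (settle 1 g T) i"
      unfolding settle_simps by (cases "status g") (auto simp: store_def)
    finally show ?thesis using 1 by simp
  next
    case 2
    have B: "(\<forall>v\<in>e. \<forall>c. Bcast v c \<notin> config \<mu> g (2 * L + 1) i) \<longleftrightarrow> e \<inter> hit g = {}" for e
      unfolding config_simps(9)[OF i] transit_bot[OF i] using 2 by (auto simp: announcement_def)
    have *: "Edge e \<in> config \<mu> g (2 * L + 1) i \<longleftrightarrow> e \<in> current g \<inter> loc i" for e
      using config_simps(2)[OF i] by blast
    have "update \<mu> i (config \<mu> g (2 * L + 1) i) =
       (if i = 0 \<and> status g = Active
         then (store g i - range Edge - range Received) \<union> Chosen ` mm {..<n} (received g)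
         else store g i - range Edge) \<union> Edge ` {e \<in> current g \<inter> loc i. e \<inter> hit g = {}}"
      unfolding update_def config_simps(1)[OF i] B *
      using config_simps(5)[OF k0] running_config 2 by auto
    also have "\<dots> = store (settle 2 g T) i"
      unfolding settle_simps by (cases "status g") (auto simp: store_def)
    finally show ?thesis using 2 by simp
  next
    case 3
    then have ne: "\<mu> \<noteq> 2" by simp
    have "update \<mu> i (config \<mu> g (2 * L + 1) i) =
        store g i \<union> (if i = 0 \<and> announced 3 g \<le> s then {Done} else {})"
      unfolding update_def total_config[OF i ne] config_simps(1)[OF i] using 3 by auto
    also have "\<dots> = store (settle 3 g T) i"
      unfolding settle_simps using announced_le_Active[of 3 g] by (auto simp: store_def)
    finally show ?thesis using 3 by simp
  qed
qed

text \<open>For \<open>\<mu> \<noteq> 0\<close> the message ignores \<open>T\<close>, and the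
  right-hand side is a point mass. The uniform form lets the last rounds of all four supersteps be
  treated alike.\<close>

lemma act_final:
  assumes g: "sound \<mu> g" and i: "i < k" and \<mu>: "\<mu> < 4" "a mod 4 = \<mu>"
  shows "act ((2 * L + 2) * a + (2 * L + 1)) i (config \<mu> g (2 * L + 1) i) =
    map_pmf (\<lambda>T. final_message \<mu> g T i)
      (sample_edges (min 1 (real s / (5 * real (announced \<mu> g) * real d))) (current g \<inter> loc i))"
proof -
  let ?X = "config \<mu> g (2 * L + 1) i"
  have mods: "((2 * L + 2) * a + (2 * L + 1)) mod (2 * L + 2) = 2 * L + 1"
     "((2 * L + 2) * a + (2 * L + 1)) div (2 * L + 2) mod 4 = \<mu>"
    using mult_add_div_mod[of "2 * L + 1" "2 * L + 2" a] \<mu> by simp_all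
  have act: "act ((2 * L + 2) * a + (2 * L + 1)) i ?X = conclude \<mu> i ?X"
    unfolding act_def Let_def mods by simp
  show ?thesis
  proof (cases "\<mu> = 0")
    case 1: True
    have eq: "stored ?X - range Sampled \<union> Sampled ` T = store (settle \<mu> g T) i"
      if "T \<subseteq> current g \<inter> loc i" for T
      unfolding config_simps(1)[OF i] settle_def using that 1 by (auto simp: store_def)
    have \<mu>2: "\<mu> \<noteq> 2" using 1 by simp
    have fin: "finite (current g \<inter> loc i)" using g subE_finite by (auto simp: sound_def)
    show ?thesis
      unfolding act conclude_def if_P[OF 1] config_simps(2)[OF i] total_config[OF i \<mu>2]
    proof (rule map_pmf_cong[OF refl])
      fix T assume "T \<in> set_pmf (sample_edges
        (min 1 (real s / (5 * real (announced \<mu> g) * real d))) (current g \<inter> loc i))"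
      then have "T \<subseteq> current g \<inter> loc i" by (rule set_sample_edges_subset[OF fin])
      note eq = eq[OF this]
      show "(\<lambda>j. if j = i then stored ?X - range Sampled \<union> Sampled ` T else {}) = final_message \<mu> g T i"
        unfolding eq final_message_def[abs_def] submitted_def using 1 by (auto simp: fun_eq_iff)
    qed
  next
    case False
    have final: "final_message \<mu> g T i = (\<lambda>j. (if j = i then store (settle \<mu> g {}) i else {}) \<union>
        (if j = 0 then Received ` (submitted \<mu> g \<inter> loc i) else {}))" for T
    proof -
      have "settle \<mu> g T = settle \<mu> g {}" using False by (simp add: settle_def)
      then show ?thesis by (simp only: final_message_def[abs_def])
    qed
    show ?thesis
      unfolding act conclude_def if_not_P[OF False] final map_pmf_const
        submit_config[OF i \<mu>(1) False] update_config[OF i \<mu>(1) False, where T = "{}"] ..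
  qed
qed

end

context sampling_simulation
begin

text \<open>A machine records only sampled edges that it stores itself, so its local sample may be
  replaced by the global one.\<close>

lemma store_local:
  assumes "T \<subseteq> current g"
  shows "store (settle \<mu> g (T \<inter> (current g \<inter> loc i))) i = store (settle \<mu> g T) i"
  using assms by (auto simp: settle_def store_def)

text \<open>The machines draw from disjoint parts of \<open>current g\<close>;
  \<open>Pi_pmf_sample_edges\<close> merges the draws into one sample, from which all messages are
  read off.\<close>

lemma item_messages_final:
  assumes g: "sound \<mu> g" and \<mu>: "\<mu> < 4" "a mod 4 = \<mu>"
  shows "item_messages k act ((2 * L + 2) * a + (2 * L + 1)) (config \<mu> g (2 * L + 1)) =
    map_pmf (\<lambda>T i. if i < k then final_message \<mu> g T i else (\<lambda>_. {}))
      (sample_edges (min 1 (real s / (5 * real (announced \<mu> g) * real d))) (current g))"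
proof -
  let ?p = "min 1 (real s / (5 * real (announced \<mu> g) * real d))"
  let ?G = "\<lambda>i. current g \<inter> loc i"
  have F: "current g \<subseteq> E" using g by (simp add: sound_def)
  have "item_messages k act ((2 * L + 2) * a + (2 * L + 1)) (config \<mu> g (2 * L + 1)) =
     Pi_pmf {..<k} (\<lambda>_. {}) (\<lambda>i. map_pmf (\<lambda>T. final_message \<mu> g T i) (sample_edges ?p (?G i)))"
    unfolding item_messages_def by (intro Pi_pmf_cong refl act_final[OF g _ \<mu>]) auto
  also have "\<dots> = map_pmf (\<lambda>h i. if i \<in> {..<k} then final_message \<mu> g (h i) i else (\<lambda>_. {}))
      (Pi_pmf {..<k} {} (\<lambda>i. sample_edges ?p (?G i)))"
    by (rule Pi_pmf_map_dep) simp
  also have "Pi_pmf {..<k} {} (\<lambda>i. sample_edges ?p (?G i)) =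
      map_pmf (\<lambda>T i. if i < k then T \<inter> ?G i else {}) (sample_edges ?p (\<Union>i<k. ?G i))"
    using loc_disj subE_finite[OF F]
    by (intro Pi_pmf_sample_edges) (auto simp: disjoint_family_on_def)
  also have "(\<Union>i<k. ?G i) = current g" by (rule loc_split[OF F])
  finally have "item_messages k act ((2 * L + 2) * a + (2 * L + 1)) (config \<mu> g (2 * L + 1)) =
    map_pmf (\<lambda>T i. if i < k then final_message \<mu> g (T \<inter> ?G i) i else (\<lambda>_. {}))
      (sample_edges ?p (current g))"
    by (simp add: map_pmf_comp cong: if_cong)
  also have "\<dots> = map_pmf (\<lambda>T i. if i < k then final_message \<mu> g T i else (\<lambda>_. {}))
      (sample_edges ?p (current g))"
  proof (rule map_pmf_cong[OF refl])
    fix T assume "T \<in> set_pmf (sample_edges ?p (current g))"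
    then have "T \<subseteq> current g" by (rule set_sample_edges_subset[OF subE_finite[OF F]])
    then show "(\<lambda>i. if i < k then final_message \<mu> g (T \<inter> ?G i) i else (\<lambda>_. {})) =
        (\<lambda>i. if i < k then final_message \<mu> g T i else (\<lambda>_. {}))"
      by (auto simp: final_message_def fun_eq_iff store_local)
  qed
  finally show ?thesis .
qed

lemma submitted_sub: "sound \<mu> g \<Longrightarrow> submitted \<mu> g \<subseteq> E"
  by (auto simp: submitted_def sound_def)

text \<open>The submitted parts unite on machine 0 to what \<open>settle\<close> still lacks.
  Nothing is in transit at the beginning of a superstep, so \<open>\<mu>'\<close> is
  arbitrary.\<close>

lemma deliver_final:
  assumes g: "sound \<mu> g" and \<mu>: "\<mu> < 4"
  shows "deliver k (\<lambda>i. if i < k then final_message \<mu> g T i else (\<lambda>_. {})) =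
    config \<mu>' (if \<mu> = 0 then settle 0 g T else advance \<mu> g) 0"
proof
  fix j
  let ?g' = "if \<mu> = 0 then settle 0 g T else advance \<mu> g"
  have settle: "store (settle \<mu> g T) j \<union> (if j = 0 then Received ` submitted \<mu> g else {}) = store ?g' j"
  proof -
    consider "\<mu> = 0" | "\<mu> = 1" | "\<mu> = 2" | "\<mu> = 3" using \<mu> by linarith
    then show ?thesis
      by cases (cases g; simp add: settle_def advance_def submitted_def store_def Let_def; blast)+
  qed
  show "deliver k (\<lambda>i. if i < k then final_message \<mu> g T i else (\<lambda>_. {})) j = config \<mu>' ?g' 0 j"
  proof (cases "j < k")
    case True
    have "deliver k (\<lambda>i. if i < k then final_message \<mu> g T i else (\<lambda>_. {})) j =
        (\<Union>i<k. final_message \<mu> g T i j)"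
      using True by (auto simp: deliver_def)
    also have "\<dots> = store (settle \<mu> g T) j \<union> (if j = 0 then \<Union>i<k. Received ` (submitted \<mu> g \<inter> loc i) else {})"
      using True by (auto simp: final_message_def split: if_splits)
    also have "(\<Union>i<k. Received ` (submitted \<mu> g \<inter> loc i)) = Received ` submitted \<mu> g"
      unfolding image_UN[symmetric] using loc_split[OF submitted_sub[OF g]] by simp
    finally show ?thesis using True settle by (simp add: config_def transit_def)
  qed (simp add: deliver_def config_def)
qed

lemma superstep_run:
  assumes g: "sound \<mu> g" and \<mu>: "\<mu> < 4" "a mod 4 = \<mu>"
  shows "map_pmf (deliver k)
      (item_messages k act ((2 * L + 2) * a + (2 * L + 1)) (config \<mu> g (2 * L + 1))) =
    map_pmf (\<lambda>g'. config \<mu>' g' 0) (superstep \<mu> g)"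
proof (cases "\<mu> = 0")
  case True
  then show ?thesis
    unfolding item_messages_final[OF g \<mu>] map_pmf_comp deliver_final[OF g \<mu>(1), where \<mu>' = \<mu>']
    by (simp add: superstep_def map_pmf_comp settle_def)
next
  case False
  then show ?thesis
    unfolding item_messages_final[OF g \<mu>] map_pmf_comp deliver_final[OF g \<mu>(1), where \<mu>' = \<mu>']
    by (simp add: superstep_def map_pmf_const)
qed

abbreviation initial :: "nat \<Rightarrow> item set" where
  "initial \<equiv> config 0 (Global Active {} {} E {}) 0"

lemma item_run_within_superstep:
  assumes "item_run k act X ((2 * L + 2) * a) = map_pmf (\<lambda>g. config (a mod 4) g 0) (global_run a)"
    and "\<rho> \<le> 2 * L + 1"
  shows "item_run k act X ((2 * L + 2) * a + \<rho>) = map_pmf (\<lambda>g. config (a mod 4) g \<rho>) (global_run a)"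
  using assms(2)
proof (induction \<rho>)
  case (Suc \<rho>)
  then have "\<rho> \<le> 2 * L" by simp
  have "item_run k act X ((2 * L + 2) * a + Suc \<rho>) =
    bind_pmf (global_run a) (\<lambda>g. map_pmf (deliver k)
      (item_messages k act ((2 * L + 2) * a + \<rho>) (config (a mod 4) g \<rho>)))"
    using Suc by (simp add: bind_map_pmf)
  also have "\<dots> = bind_pmf (global_run a) (\<lambda>g. return_pmf (config (a mod 4) g (Suc \<rho>)))"
  proof (intro bind_pmf_cong refl)
    fix g assume "g \<in> set_pmf (global_run a)"
    then have "sound (a mod 4) g" by (rule sound_global_run)
    then show "map_pmf (deliver k) (item_messages k act ((2 * L + 2) * a + \<rho>) (config (a mod 4) g \<rho>)) =
        return_pmf (config (a mod 4) g (Suc \<rho>))"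
      using \<open>\<rho> \<le> 2 * L\<close> by (simp only: item_messages_round deliver_round map_return_pmf)
  qed
  finally show ?case by (simp add: map_pmf_def)
qed (use assms(1) in simp)

lemma item_run_superstep:
  "item_run k act initial ((2 * L + 2) * a) = map_pmf (\<lambda>g. config (a mod 4) g 0) (global_run a)"
proof (induction a)
  case (Suc a)
  have "item_run k act initial ((2 * L + 2) * Suc a) =
      item_run k act initial (Suc ((2 * L + 2) * a + (2 * L + 1)))"
    by (rule arg_cong) simp
  also have "\<dots> = bind_pmf (global_run a) (\<lambda>g. map_pmf (deliver k)
      (item_messages k act ((2 * L + 2) * a + (2 * L + 1)) (config (a mod 4) g (2 * L + 1))))"
    unfolding item_run.simps item_run_within_superstep[OF Suc.IH order_refl] by (simp add: bind_map_pmf)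
  also have "\<dots> = bind_pmf (global_run a) (\<lambda>g. map_pmf (\<lambda>g'. config (Suc a mod 4) g' 0) (superstep (a mod 4) g))"
    by (intro bind_pmf_cong refl superstep_run sound_global_run) auto
  finally show ?case by (simp add: map_bind_pmf)
qed simp

lemma item_run_eq:
  fixes r :: nat
  defines "\<rho> \<equiv> r mod (2 * L + 2)" and "a \<equiv> r div (2 * L + 2)"
  shows "item_run k act initial r = map_pmf (\<lambda>g. config (a mod 4) g \<rho>) (global_run a)"
proof -
  have "\<rho> < 2 * L + 2" unfolding \<rho>_def by (rule mod_less_divisor) simp
  then have "item_run k act initial ((2 * L + 2) * a + \<rho>) = map_pmf (\<lambda>g. config (a mod 4) g \<rho>) (global_run a)"
    by (intro item_run_within_superstep item_run_superstep) simp
  moreover have "(2 * L + 2) * a + \<rho> = r"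
    unfolding a_def \<rho>_def by (rule mult_div_mod_eq)
  ultimately show ?thesis by simp
qed

subsection \<open>Agreement with Iterated-Sampling\<close>

definition abstract_state :: "global_state \<Rightarrow> nat sampling_state" where
  "abstract_state g =
     (case status g of
        Active \<Rightarrow> Running (chosen g) (current g)
      | Aborted \<Rightarrow> Failed
      | Completed \<Rightarrow> Finished (chosen g \<union> mm (unmatched {..<n} (chosen g)) (received g)))"

text \<open>Only superstep 0 is random; the other three collapse to one deterministic map of its
  outcome.\<close>

lemma four_supersteps:
  "global_run (4 * Suc t) =
     bind_pmf (global_run (4 * t)) (\<lambda>g. map_pmf (\<lambda>g1. advance 3 (advance 2 (advance 1 g1))) (superstep 0 g))"
proof -
  have mods: "(4 * t) mod 4 = 0" "Suc (4 * t) mod 4 = 1" "Suc (Suc (4 * t)) mod 4 = 2"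
     "Suc (Suc (Suc (4 * t))) mod 4 = 3" by presburger+
  have "4 * Suc t = Suc (Suc (Suc (Suc (4 * t))))" by simp
  then have "global_run (4 * Suc t) = bind_pmf (bind_pmf (bind_pmf (bind_pmf (global_run (4 * t))
      (superstep 0)) (superstep 1)) (superstep 2)) (superstep 3)"
    by (simp only: global_run.simps mods)
  also have "\<dots> = bind_pmf (global_run (4 * t)) (\<lambda>g. bind_pmf (superstep 0 g)
      (\<lambda>g1. return_pmf (advance 3 (advance 2 (advance 1 g1)))))"
    by (simp add: bind_assoc_pmf superstep_def[of 1] superstep_def[of 2] superstep_def[of 3]
        superstep_def[of "Suc 0"] bind_return_pmf)
  finally show ?thesis by (simp add: map_pmf_def)
qed

text \<open>An active state starts with nothing received, so the sample alone is matched; if it is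
  too large, the abort survives the pass since \<open>s + 1\<close> is announced from then on. A run
  that has ended keeps sampling, but \<open>abstract_state\<close> sees only components that no
  longer change.\<close>

lemma abstract_iteration:
  assumes g: "sound 0 g"
  shows "map_pmf (\<lambda>g1. abstract_state (advance 3 (advance 2 (advance 1 g1)))) (superstep 0 g) =
    iteration d s mm {..<n} E (abstract_state g)"
proof -
  obtain st M R F T where geq: "g = Global st M R F T" by (cases g)
  have F: "F \<subseteq> E" and fin: "finite F" using g subE_finite by (auto simp: sound_def geq)
  show ?thesis
  proof (cases st)
    case Active
    have FM: "F = untouched M" and R: "R = {}" using g Active by (auto simp: sound_def geq)
    have step: "abstract_state (advance 3 (advance 2 (advance 1 (Global Active M {} F T')))) =
      (if card T' > s then Failed
         else
           (let M1 = M \<union> mm {..<n} T';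
                I = unmatched {..<n} M1
            in if card (induced_edges E I) > s then Running M1 (induced_edges E I)
               else Finished (M1 \<union> mm I (induced_edges E I))))" if "T' \<subseteq> F" for T'
    proof (cases "card T' > s")
      case True
      then show ?thesis
        by (simp add: advance_def announced_def abstract_state_def Let_def)
    next
      case False
      define M1 where "M1 = M \<union> mm {..<n} T'"
      have "induced_edges E (unmatched {..<n} M1) = {e \<in> E. e \<inter> \<Union>M1 = {}}"
        by (rule induced_unmatched[OF E_sub])
      also have "\<dots> = {e \<in> F. e \<inter> \<Union>M1 = {}}"
        unfolding FM untouched_def M1_def by auto
      finally have ind: "induced_edges E (unmatched {..<n} M1) = {e \<in> F. e \<inter> \<Union>M1 = {}}" .
      show ?thesis
        using False unfolding M1_def[symmetric] Let_def ind
        by (simp add: advance_def announced_def abstract_state_def Let_def hit_def flip: M1_def)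
    qed
    show ?thesis
      unfolding geq Active R
      by (simp add: superstep_def abstract_state_def announced_def map_pmf_comp)
         (intro map_pmf_cong refl, use step[OF set_sample_edges_subset[OF fin]] in
            \<open>simp add: abstract_state_def\<close>)
  next
    case Aborted
    then show ?thesis
      by (simp add: geq superstep_def advance_def announced_def abstract_state_def map_pmf_comp Let_def map_pmf_const)
  next
    case Completed
    then show ?thesis
      by (simp add: geq superstep_def advance_def announced_def abstract_state_def map_pmf_comp Let_def map_pmf_const)
  qed
qed

lemma abstract_global_run:
  "map_pmf abstract_state (global_run (4 * t)) = iterated_sampling d s mm {..<n} E t"
proof (induction t)
  case 0
  then show ?case by (simp add: abstract_state_def)
next
  case (Suc t)
  have "map_pmf abstract_state (global_run (4 * Suc t)) =
    bind_pmf (global_run (4 * t)) (\<lambda>g. iteration d s mm {..<n} E (abstract_state g))"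
    unfolding four_supersteps map_bind_pmf map_pmf_comp
    by (intro bind_pmf_cong refl abstract_iteration) (use sound_global_run[of _ "4 * t"] in simp)
  then show ?case by (simp add: Suc.IH[symmetric] bind_map_pmf)
qed

lemma result_config: "result (config \<mu> g 0 0) = sampling_result (abstract_state g)"
proof -
  have k0: "0 < k" using k by simp
  show ?thesis
    by (cases "status g") (simp_all add: result_def config_simps[OF k0] abstract_state_def)
qed

lemma result_item_run:
  "map_pmf (\<lambda>X. result (X 0)) (item_run k act initial (4 * (2 * L + 2) * t)) =
    map_pmf sampling_result (iterated_sampling d s mm {..<n} E t)"
proof -
  have "4 * (2 * L + 2) * t = (2 * L + 2) * (4 * t)" by (simp add: algebra_simps)
  then have "item_run k act initial (4 * (2 * L + 2) * t) =
      map_pmf (\<lambda>g. config ((4 * t) mod 4) g 0) (global_run (4 * t))"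
    by (simp only: item_run_superstep)
  then show ?thesis
    by (simp only: map_pmf_comp result_config abstract_global_run[symmetric])
qed

end

subsection \<open>Message sizes\<close>

text \<open>The data that a machine keeps count once as sent and once as received. Only the
  remaining traffic \<open>x\<close> has to be bounded per sender and per receiver.\<close>

lemma messages_withinI:
  fixes k a c b :: nat
  assumes msg: "\<And>i j. i < k \<Longrightarrow> msg i j = (if j = i then A i else {}) \<union> x i j"
    and A: "\<And>i. i < k \<Longrightarrow> A i \<subseteq> U" "\<And>i. i < k \<Longrightarrow> card (A i) \<le> a"
    and x: "\<And>i j. i < k \<Longrightarrow> j < k \<Longrightarrow> x i j \<subseteq> U"
      "\<And>j. j < k \<Longrightarrow> (\<Sum>i<k. card (x i j)) \<le> c" "\<And>i. i < k \<Longrightarrow> (\<Sum>j<k. card (x i j)) \<le> c"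
    and b: "a + c \<le> b"
  shows "messages_within k b U msg"
  unfolding messages_within_def
proof (intro conjI allI impI)
  have le: "card (msg i j) \<le> (if i = j then card (A i) else 0) + card (x i j)" if "i < k" for i j
    using card_Un_le[of "if j = i then A i else {}" "x i j"] by (auto simp: msg[OF that])
  show "msg i j \<subseteq> U" if "i < k" "j < k" for i j
    using msg[OF that(1)] A(1)[OF that(1)] x(1)[OF that] by auto
  show "(\<Sum>i<k. card (msg i j)) \<le> b" if "j < k" for j
  proof -
    have "(\<Sum>i<k. card (msg i j)) \<le> (\<Sum>i<k. (if i = j then card (A i) else 0) + card (x i j))"
      using le by (intro sum_mono) auto
    also have "\<dots> = card (A j) + (\<Sum>i<k. card (x i j))"
      using that by (simp add: sum.distrib)
    finally show ?thesis using A(2)[OF that] x(2)[OF that] b by linarith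
  qed
  show "(\<Sum>j<k. card (msg i j)) \<le> b" if "i < k" for i
  proof -
    have "(\<Sum>j<k. card (msg i j)) \<le> (\<Sum>j<k. (if i = j then card (A i) else 0) + card (x i j))"
      using le[OF that] by (intro sum_mono) auto
    also have "\<dots> = card (A i) + (\<Sum>j<k. card (x i j))"
      using that by (simp add: sum.distrib)
    finally show ?thesis using A(2)[OF that] x(3)[OF that] b by linarith
  qed
qed

lemma sum_card_disjoint_le:
  assumes "finite Q" "finite I" "\<And>i. i \<in> I \<Longrightarrow> S i \<subseteq> Q"
    and "\<And>i j. i \<in> I \<Longrightarrow> j \<in> I \<Longrightarrow> i \<noteq> j \<Longrightarrow> S i \<inter> S j = {}"
  shows "(\<Sum>i\<in>I. card (S i)) \<le> card Q"
proof -
  have "(\<Sum>i\<in>I. card (S i)) = card (\<Union>i\<in>I. S i)"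
    using assms finite_subset[OF assms(3,1)] by (intro card_UN_disjoint[symmetric]) auto
  also have "\<dots> \<le> card Q" using assms by (intro card_mono) auto
  finally show ?thesis .
qed

text \<open>Division by \<open>k\<close> is injective on a residue class modulo \<open>k\<close>.
  Such a class describes the shifted nodes that share a host.\<close>

lemma card_residue_class_le:
  assumes "k \<ge> (1::nat)"
  shows "finite {z. z < k + n \<and> z mod k = i}" "card {z. z < k + n \<and> z mod k = i} \<le> n div k + 2"
proof -
  let ?Z = "{z. z < k + n \<and> z mod k = i}"
  show "finite ?Z" by simp
  have "inj_on (\<lambda>z. z div k) ?Z"
    by (rule inj_onI) (metis (mono_tags, lifting) div_mult_mod_eq mem_Collect_eq)
  moreover have "(\<lambda>z. z div k) ` ?Z \<subseteq> {..n div k + 1}"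
  proof
    fix x assume "x \<in> (\<lambda>z. z div k) ` ?Z"
    then obtain z where "z < k + n" "x = z div k" by auto
    then have "x \<le> (k + n) div k" using div_le_mono[of z "k + n" k] by simp
    then show "x \<in> {..n div k + 1}" using assms by simp
  qed
  ultimately have "card ?Z \<le> card {..n div k + 1}" by (rule card_inj_on_le) simp
  then show "card ?Z \<le> n div k + 2" by simp
qed

context sampling_program
begin

text \<open>Counts are at most \<open>card E \<le> n ^ d\<close>, and an announcement may also be
  \<open>s + 1\<close>; hence the range \<open>N\<close>.\<close>

definition universe :: "item set" where
  "universe =
     (let Es = {e. e \<subseteq> {..<n} \<and> card e = d}; N = {..n ^ d + s + 1}
      in Edge ` Es \<union> Sampled ` Es \<union> Chosen ` Es \<union> Received ` Es \<union> {Abort, Done} \<union>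
         case_prod Count ` ({..<k} \<times> N) \<union> case_prod Bcast ` ({..<n} \<times> N))"

lemma universe_iff:
  "Edge e \<in> universe \<longleftrightarrow> e \<subseteq> {..<n} \<and> card e = d"
  "Sampled e \<in> universe \<longleftrightarrow> e \<subseteq> {..<n} \<and> card e = d"
  "Chosen e \<in> universe \<longleftrightarrow> e \<subseteq> {..<n} \<and> card e = d"
  "Received e \<in> universe \<longleftrightarrow> e \<subseteq> {..<n} \<and> card e = d"
  "Abort \<in> universe" "Done \<in> universe"
  "Count i c \<in> universe \<longleftrightarrow> i < k \<and> c \<le> n ^ d + s + 1"
  "Bcast i c \<in> universe \<longleftrightarrow> i < n \<and> c \<le> n ^ d + s + 1"
  by (auto simp: universe_def Let_def)

lemma finite_universe: "finite universe"
  by (simp add: universe_def Let_def)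

lemma card_universe_le: "card universe \<le> 4 * n ^ d + 2 + (k + n) * (n ^ d + s + 2)"
proof -
  define Es where "Es = {e. e \<subseteq> {..<n} \<and> card e = d}"
  define N where "N = {..n ^ d + s + 1}"
  have "card Es = n choose d" unfolding Es_def by (subst n_subsets) auto
  also have "\<dots> \<le> n ^ d"
    by (cases "d \<le> n") (auto intro: binomial_le_pow simp: binomial_eq_0)
  finally have Es: "card Es \<le> n ^ d" .
  have fin: "finite Es" "finite N" by (simp_all add: Es_def N_def)
  have im: "card (f ` Es) \<le> n ^ d" for f :: "nat set \<Rightarrow> item"
    using card_image_le[OF fin(1)] Es by (rule le_trans)
  have im2: "card (f ` ({..<m} \<times> N)) \<le> m * (n ^ d + s + 2)" for f :: "nat \<times> nat \<Rightarrow> item" and m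
    using card_image_le[of "{..<m} \<times> N" f] fin(2) by (simp add: card_cartesian_product N_def)
  have U: "card (A \<union> B) \<le> a + b" if "card A \<le> a" "card B \<le> b" for A B :: "item set" and a b
    using card_Un_le[of A B] that by linarith
  have "card universe \<le> n ^ d + n ^ d + n ^ d + n ^ d + 2 + k * (n ^ d + s + 2) + n * (n ^ d + s + 2)"
    unfolding universe_def Let_def Es_def[symmetric] N_def[symmetric]
    by (intro U im im2) simp
  then show ?thesis by (simp add: algebra_simps)
qed

end

context sampling_simulation
begin

text \<open>The part of \<open>sound\<close> that bounds message sizes. It mentions no superstep, so
  it transfers componentwise to \<open>settle \<mu> g T\<close>.\<close>

definition bounded_state :: "global_state \<Rightarrow> bool" where
  "bounded_state g \<longleftrightarrow> current g \<subseteq> E \<and> sampled g \<subseteq> E \<and> received g \<subseteq> E \<and>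
     card (received g) \<le> s \<and> matching E (chosen g)"

lemma bounded_sound: "sound \<mu> g \<Longrightarrow> bounded_state g"
  by (auto simp: sound_def bounded_state_def)

lemma bounded_settle:
  assumes g: "sound \<mu> g" and \<mu>: "\<mu> < 4" and T: "T \<subseteq> current g"
  shows "bounded_state (settle \<mu> g T)"
proof (cases "\<mu> = 0")
  case True
  then show ?thesis using bounded_sound[OF g] T by (auto simp: bounded_state_def settle_def)
next
  case False
  then have "advance \<mu> g \<in> set_pmf (superstep \<mu> g)" by (simp add: superstep_def)
  then have "bounded_state (advance \<mu> g)" using sound_superstep[OF g \<mu>] bounded_sound by blast
  then show ?thesis using bounded_sound[OF g] False by (auto simp: bounded_state_def settle_def)
qed

lemma edge_in: "e \<in> E \<Longrightarrow> e \<subseteq> {..<n} \<and> card e = d"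
  using E by (auto simp: uniform_hypergraph_def)

lemma store_universe:
  assumes "bounded_state g"
  shows "store g i \<subseteq> universe"
proof
  fix x assume "x \<in> store g i"
  then show "x \<in> universe"
    using assms edge_in
    by (auto simp: store_def bounded_state_def matching_def universe_iff split: if_splits)
qed

lemma card_store_le:
  assumes g: "bounded_state g" and i: "i < k"
  shows "card (store g i) \<le> 3 * s + 3 * n"
proof -
  have loc: "finite (loc i)" "card (loc i) \<le> s"
    using loc_sub[OF i] subE_finite loc_card[OF i] by auto
  have c1: "card (F \<inter> loc i) \<le> s" for F
    using card_mono[OF loc(1), of "F \<inter> loc i"] loc(2) by simp
  have c2: "card (chosen g) \<le> n" "card (received g) \<le> s"
    using g card_matching_le[OF _ E d, of "chosen g"] by (auto simp: bounded_state_def)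
  have fin: "finite (chosen g)" "finite (received g)"
    using g subE_finite by (auto simp: bounded_state_def matching_def)
  have U: "card (A \<union> B) \<le> a + b" if "card A \<le> a" "card B \<le> b" for A B :: "item set" and a b
    using card_Un_le[of A B] that by linarith
  have im: "card (f ` A) \<le> a" if "finite A" "card A \<le> a" for f :: "nat set \<Rightarrow> item" and A a
    using card_image_le[OF that(1), of f] that(2) by linarith
  have le: "card (Edge ` (current g \<inter> loc i)) \<le> s" "card (Sampled ` (sampled g \<inter> loc i)) \<le> s"
    using loc(1) c1 by (auto intro!: im)
  have "card (if status g = Aborted then {Abort} else {}) \<le> 1"
    "card (if status g = Completed then {Done} else {}) \<le> 1" by auto
  then have "card (Chosen ` chosen g \<union> Received ` received g \<union>
        (if status g = Aborted then {Abort} else {}) \<union> (if status g = Completed then {Done} else {}))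
      \<le> n + s + 1 + 1"
    by (intro U im[OF fin(1) c2(1)] im[OF fin(2) c2(2)])
  then have "card (if i = 0 then Chosen ` chosen g \<union> Received ` received g \<union>
        (if status g = Aborted then {Abort} else {}) \<union> (if status g = Completed then {Done} else {})
      else {}) \<le> n + s + 1 + 1" by simp
  then have "card (store g i) \<le> s + s + (n + s + 1 + 1)"
    unfolding store_def by (intro U le)
  \<comment> \<open>The two flags are absorbed by \<open>n \<ge> 1\<close>.\<close>
  then show ?thesis using n by simp
qed

text \<open>In the summation tree a machine has at most \<open>n\<close> children and one
  parent.\<close>

lemma messages_within_count:
  assumes g: "sound \<mu> g"
  shows "messages_within k (4 * s + 6 * n) universe (\<lambda>i. if i < k then count_message \<mu> g \<rho> i else (\<lambda>_. {}))"
proof (rule messages_withinI[where A = "store g" and a = "3 * s + 3 * n" and c = n and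
      x = "\<lambda>i j. if j = i div n then {Count i (partial_count \<mu> g \<rho> i)} else {}"])
  have "partial_count \<mu> g \<rho> i \<le> n ^ d + s + 1" for i
    using partial_count_le[OF g, of \<rho> i] card_uniform_hypergraph_le[OF E] by simp
  then show "(if j = i div n then {Count i (partial_count \<mu> g \<rho> i)} else {}) \<subseteq> universe" if "i < k" for i j
    using that by (simp add: universe_iff)
  show "(\<Sum>i<k. card (if j = i div n then {Count i (partial_count \<mu> g \<rho> i)} else {})) \<le> n" for j
  proof -
    have "(\<Sum>i<k. card (if j = i div n then {Count i (partial_count \<mu> g \<rho> i)} else {})) =
        (\<Sum>i<k. if j = i div n then 1 else 0)" by (intro sum.cong) auto
    also have "\<dots> = card {i \<in> {..<k}. j = i div n}" by (simp add: sum.If_cases Int_def)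
    also have "\<dots> \<le> card ((\<lambda>r. j * n + r) ` {..<n})"
    proof (intro card_mono subsetI)
      fix i assume "i \<in> {i \<in> {..<k}. j = i div n}"
      then have "i = j * n + i mod n" "i mod n < n" using n by auto
      then show "i \<in> (\<lambda>r. j * n + r) ` {..<n}" by blast
    qed simp
    also have "\<dots> \<le> n" using card_image_le[of "{..<n}"] by simp
    finally show ?thesis .
  qed
  show "(\<Sum>j<k. card (if j = i div n then {Count i (partial_count \<mu> g \<rho> i)} else {})) \<le> n" for i
  proof -
    have "(\<Sum>j<k. card (if j = i div n then {Count i (partial_count \<mu> g \<rho> i)} else {})) =
        (\<Sum>j<k. if j = i div n then 1 else 0)" by (intro sum.cong) auto
    also have "\<dots> \<le> 1" by simp
    finally show ?thesis using n by simp
  qed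
qed (use bounded_sound[OF g] store_universe card_store_le in \<open>auto simp: count_message_def\<close>)

section \<open>Load of the broadcast trees\<close>

definition route_pairs :: "nat \<Rightarrow> (nat \<times> nat) set" where
  "route_pairs m = {(v, y). v < n \<and> y * n ^ m < k}"

lemma finite_route_pairs: "finite (route_pairs m)"
proof -
  have "y < k" if "y * n ^ m < k" for y
    using that n by (metis le_less_trans mult.right_neutral mult_le_mono2 one_le_power)
  then have "route_pairs m \<subseteq> {..<n} \<times> {..<k}" by (auto simp: route_pairs_def)
  then show ?thesis by (rule finite_subset) simp
qed

lemma route_pairs_lt: "(v, y) \<in> route_pairs m \<Longrightarrow> y < k"
  using n unfolding route_pairs_def
  by (metis (mono_tags, lifting) case_prodD le_less_trans mem_Collect_eq mult.right_neutral mult_le_mono2 one_le_power)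

text \<open>For \<open>m > 0\<close> a pair is recovered from \<open>y * n ^ m + v\<close>, because
  \<open>v < n \<le> n ^ m\<close>. These numbers lie below \<open>k + n\<close> and, for a fixed
  host, in one residue class modulo \<open>k\<close>. On level 0 machine \<open>j\<close> is a leaf
  of all \<open>n\<close> trees.\<close>

lemma card_incoming_le:
  assumes "m \<le> L"
  shows "card {(v, y) \<in> route_pairs m. position m v y = j} \<le> 3 * n"
proof (cases "m = 0")
  case True
  then have "{(v, y) \<in> route_pairs m. position m v y = j} \<subseteq> {..<n} \<times> {j}"
    by (auto simp: route_pairs_def position_def)
  then have "card {(v, y) \<in> route_pairs m. position m v y = j} \<le> card ({..<n} \<times> {j})"
    by (intro card_mono) auto
  then show ?thesis by (simp add: card_cartesian_product)
next
  case False
  let ?S = "{(v, y) \<in> route_pairs m. position m v y = j}"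
  let ?Z = "{z. z < k + n \<and> z mod k = j}"
  have nm: "n \<le> n ^ m" using False n by (simp add: self_le_power)
  have "inj_on (\<lambda>(v, y). y * n ^ m + v) ?S"
  proof (rule inj_onI, clarify)
    fix v y v' y' assume *: "(v, y) \<in> route_pairs m" "(v', y') \<in> route_pairs m"
      and eq: "y * n ^ m + v = y' * n ^ m + v'"
    have lt: "v < n ^ m" "v' < n ^ m" using * nm by (auto simp: route_pairs_def)
    have "y = y'"
      using eq mult_add_div_mod(2)[OF lt(1), of y] mult_add_div_mod(2)[OF lt(2), of y']
      by (simp only: mult.commute)
    then show "v = v' \<and> y = y'" using eq by simp
  qed
  moreover have "(\<lambda>(v, y). y * n ^ m + v) ` ?S \<subseteq> ?Z"
    using False assms by (auto simp: route_pairs_def position_def)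
  ultimately have "card ?S \<le> card ?Z" by (rule card_inj_on_le) simp
  also have "\<dots> \<le> n div k + 2" by (rule card_residue_class_le[OF k(1)])
  also have "\<dots> \<le> 3 * n" using n div_le_dividend[of n k] by linarith
  finally show ?thesis .
qed

text \<open>Hosted nodes times \<open>n\<close> children would be quadratic in \<open>n\<close> when
  there are few machines. But a node has at most \<open>min n k\<close> children with nonempty
  blocks, which balances the \<open>n div k + 2\<close> nodes. The root has the single child
  \<open>y = 0\<close>, as \<open>k \<le> n ^ L\<close>.\<close>

lemma card_outgoing_le:
  assumes "0 < m" "m \<le> Suc L"
  shows "card {(v, y) \<in> route_pairs (m - 1). position m v (y div n) = i} \<le> 3 * n"
proof (cases "m = Suc L")
  case True
  have "y = 0" if "y * n ^ L < k" for y
    using that k(2) by (cases y) auto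
  then have "{(v, y) \<in> route_pairs (m - 1). position m v (y div n) = i} \<subseteq> {..<n} \<times> {0}"
    using True by (auto simp: route_pairs_def)
  then have "card {(v, y) \<in> route_pairs (m - 1). position m v (y div n) = i} \<le> card ({..<n} \<times> {0::nat})"
    by (intro card_mono) auto
  then show ?thesis by (simp add: card_cartesian_product)
next
  case False
  let ?S = "{(v, y) \<in> route_pairs (m - 1). position m v (y div n) = i}"
  let ?Z = "{z. z < k + n \<and> z mod k = i}"
  have nm: "n \<le> n ^ m" using assms n by (simp add: self_le_power)
  have "inj_on (\<lambda>(v, y). (y div n * n ^ m + v, y mod n)) ?S"
  proof (rule inj_onI, clarify)
    fix v y v' y' assume *: "(v, y) \<in> route_pairs (m - 1)" "(v', y') \<in> route_pairs (m - 1)"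
      and eq: "y div n * n ^ m + v = y' div n * n ^ m + v'" and mod: "y mod n = y' mod n"
    have lt: "v < n ^ m" "v' < n ^ m" using * nm by (auto simp: route_pairs_def)
    have "y div n = y' div n"
      using eq mult_add_div_mod(2)[OF lt(1), of "y div n"] mult_add_div_mod(2)[OF lt(2), of "y' div n"]
      by (simp only: mult.commute)
    then show "v = v' \<and> y = y'" using eq mod by (metis add_left_cancel div_mult_mod_eq)
  qed
  moreover have "(\<lambda>(v, y). (y div n * n ^ m + v, y mod n)) ` ?S \<subseteq> ?Z \<times> {..<min n k}"
  proof
    fix x assume "x \<in> (\<lambda>(v, y). (y div n * n ^ m + v, y mod n)) ` ?S"
    then obtain v y where vy: "(v, y) \<in> route_pairs (m - 1)" and pos: "position m v (y div n) = i"
      and x: "x = (y div n * n ^ m + v, y mod n)" by auto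
    have "y div n * n ^ m < k" using vy div_block[OF assms(1)] by (auto simp: route_pairs_def)
    moreover have "y mod n < min n k"
      using n route_pairs_lt[OF vy] le_less_trans[OF mod_less_eq_dividend] by simp
    moreover have "position m v (y div n) = (y div n * n ^ m + v) mod k"
      using False assms by (simp add: position_def)
    ultimately show "x \<in> ?Z \<times> {..<min n k}"
      using vy by (auto simp: route_pairs_def x pos)
  qed
  ultimately have "card ?S \<le> card (?Z \<times> {..<min n k})" by (rule card_inj_on_le) simp
  also have "\<dots> \<le> (n div k + 2) * min n k"
    using card_residue_class_le(2)[OF k(1), of n i]
    by (simp only: card_cartesian_product card_lessThan mult_right_mono)
  \<comment> \<open>The minimum is bounded by \<open>k\<close> in the first summand and by
    \<open>n\<close> in the second.\<close>
  also have "\<dots> \<le> n div k * k + 2 * n"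
    by (simp only: add_mult_distrib) (intro add_mono mult_left_mono; simp)
  also have "\<dots> \<le> 3 * n" using div_times_less_eq_dividend[of n k] by linarith
  finally show ?thesis .
qed

lemma messages_within_broadcast:
  assumes g: "sound \<mu> g" and \<rho>: "L \<le> \<rho>" "\<rho> \<le> 2 * L"
  shows "messages_within k (4 * s + 6 * n) universe
    (\<lambda>i. if i < k then broadcast_message \<mu> g \<rho> i else (\<lambda>_. {}))"
proof -
  define m where "m = 2 * L + 1 - \<rho>"
  have m: "0 < m" "m \<le> Suc L" using \<rho> by (auto simp: m_def)
  define B where "B = announcement \<mu> g"
  \<comment> \<open>All items of one announcement share the second component, so an item is
    determined by \<open>v\<close>, and counting pairs \<open>(v, y)\<close> bounds the
    traffic.\<close>
  define val where "val = (if \<mu> = 2 then 0 else announced \<mu> g)"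
  have val: "v < n \<and> c = val" if "Bcast v c \<in> B" for v c
    using that hit_sub[OF g] n by (auto simp: B_def val_def announcement_def split: if_splits)
  have "val \<le> n ^ d + s + 1"
  proof -
    have "(if \<mu> = 1 then sampled g else current g) \<subseteq> E" using g by (simp add: sound_def)
    then have "card (if \<mu> = 1 then sampled g else current g) \<le> n ^ d"
      using card_mono[OF E_finite] card_uniform_hypergraph_le[OF E] le_trans by (metis card_lessThan)
    then show ?thesis by (auto simp: val_def announced_def)
  qed
  then have BU: "route m i B j \<subseteq> universe" for i j
    using val by (auto simp: route_def universe_iff)
  define S where "S = (\<lambda>i j. {(v, y) \<in> route_pairs (m - 1).
      position (m - 1) v y = j \<and> position m v (y div n) = i})"
  have finS: "finite (S i j)" for i j
    by (rule finite_subset[OF _ finite_route_pairs]) (auto simp: S_def)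
  have le: "card (route m i B j) \<le> card (S i j)" for i j
  proof -
    have "route m i B j \<subseteq> (\<lambda>(v, y). Bcast v val) ` S i j"
      using val by (force simp: route_def S_def route_pairs_def)
    then show ?thesis by (rule surj_card_le[OF finS])
  qed
  show ?thesis
  proof (rule messages_withinI[where A = "store g" and a = "3 * s + 3 * n" and c = "3 * n" and
        x = "\<lambda>i j. route m i B j"])
    show "(\<Sum>i<k. card (route m i B j)) \<le> 3 * n" for j
    proof -
      have "(\<Sum>i<k. card (route m i B j)) \<le> (\<Sum>i<k. card (S i j))" by (intro sum_mono le)
      also have "\<dots> \<le> card {(v, y) \<in> route_pairs (m - 1). position (m - 1) v y = j}"
        using finite_route_pairs[of "m - 1"]
        by (intro sum_card_disjoint_le) (auto simp: S_def elim: rev_finite_subset)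
      also have "\<dots> \<le> 3 * n" using m by (intro card_incoming_le) simp
      finally show ?thesis .
    qed
    show "(\<Sum>j<k. card (route m i B j)) \<le> 3 * n" for i
    proof -
      have "(\<Sum>j<k. card (route m i B j)) \<le> (\<Sum>j<k. card (S i j))" by (intro sum_mono le)
      also have "\<dots> \<le> card {(v, y) \<in> route_pairs (m - 1). position m v (y div n) = i}"
        using finite_route_pairs[of "m - 1"]
        by (intro sum_card_disjoint_le) (auto simp: S_def elim: rev_finite_subset)
      also have "\<dots> \<le> 3 * n" by (rule card_outgoing_le[OF m])
      finally show ?thesis .
    qed
  qed (use bounded_sound[OF g] store_universe card_store_le BU in
        \<open>auto simp: broadcast_message_def m_def B_def\<close>)
qed

lemma messages_within_final:
  assumes g: "sound \<mu> g" and \<mu>: "\<mu> < 4" and T: "T \<subseteq> current g"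
  shows "messages_within k (4 * s + 6 * n) universe
    (\<lambda>i. if i < k then final_message \<mu> g T i else (\<lambda>_. {}))"
proof (rule messages_withinI[where A = "store (settle \<mu> g T)" and a = "3 * s + 3 * n" and c = s and
      x = "\<lambda>i j. if j = 0 then Received ` (submitted \<mu> g \<inter> loc i) else {}"])
  have sub: "submitted \<mu> g \<subseteq> E" by (rule submitted_sub[OF g])
  have c: "card (submitted \<mu> g) \<le> s"
    by (auto simp: submitted_def announced_def split: if_splits)
  have im: "card (Received ` A) = card A" for A
    by (rule card_image) (auto simp: inj_on_def)
  show "(if j = 0 then Received ` (submitted \<mu> g \<inter> loc i) else {}) \<subseteq> universe" for i j
    using sub edge_in by (auto simp: universe_iff)
  show "(\<Sum>i<k. card (if j = 0 then Received ` (submitted \<mu> g \<inter> loc i) else {})) \<le> s" for j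
    using c sum_card_loc[OF sub] by (cases "j = 0") (auto simp: im)
  show "(\<Sum>j<k. card (if j = 0 then Received ` (submitted \<mu> g \<inter> loc i) else {})) \<le> s" if "i < k" for i
  proof -
    have "(\<Sum>j<k. card (if j = 0 then Received ` (submitted \<mu> g \<inter> loc i) else {})) =
        (\<Sum>j<k. if j = 0 then card (submitted \<mu> g \<inter> loc i) else 0)"
      by (intro sum.cong) (auto simp: im)
    also have "\<dots> \<le> card (submitted \<mu> g)"
      using subE_finite[OF sub] by (auto intro: card_mono)
    finally show ?thesis using c by simp
  qed
qed (use bounded_settle[OF g \<mu> T] store_universe card_store_le in \<open>auto simp: final_message_def\<close>)

text \<open>The stores cost \<open>3 * s + 3 * n\<close>; the traffic costs \<open>n\<close> while
  counting, \<open>3 * n\<close> while broadcasting and \<open>s\<close> in the last round of a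
  superstep. So \<open>4 * s + 6 * n\<close> covers every round.\<close>

lemma messages_within_run:
  assumes X: "X \<in> set_pmf (item_run k act initial r)"
    and msg: "msg \<in> set_pmf (item_messages k act r X)"
  shows "messages_within k (4 * s + 6 * n) universe msg"
proof -
  define \<rho> a \<mu> where "\<rho> = r mod (2 * L + 2)" and "a = r div (2 * L + 2)" and "\<mu> = a mod 4"
  have \<mu>: "\<mu> < 4" by (simp add: \<mu>_def)
  have r: "(2 * L + 2) * a + \<rho> = r"
    unfolding a_def \<rho>_def by (rule mult_div_mod_eq)
  obtain g where g: "g \<in> set_pmf (global_run a)" and X_eq: "X = config \<mu> g \<rho>"
    using X unfolding item_run_eq \<rho>_def a_def \<mu>_def by auto
  have snd: "sound \<mu> g" using sound_global_run[OF g] by (simp add: \<mu>_def)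
  have "\<rho> < 2 * L + 2" unfolding \<rho>_def by (rule mod_less_divisor) simp
  then consider "\<rho> < L" | "L \<le> \<rho>" "\<rho> \<le> 2 * L" | "\<rho> = 2 * L + 1" by linarith
  then show ?thesis
  proof cases
    case 1
    have "msg = (\<lambda>i. if i < k then count_message \<mu> g \<rho> i else (\<lambda>_. {}))"
      using msg item_messages_round[OF snd \<mu> \<mu>_def[symmetric], of \<rho>] 1
      unfolding r X_eq round_message_def if_P[OF 1] by simp
    then show ?thesis using messages_within_count[OF snd] by simp
  next
    case 2
    then have nl: "\<not> \<rho> < L" by simp
    have "msg = (\<lambda>i. if i < k then broadcast_message \<mu> g \<rho> i else (\<lambda>_. {}))"
      using msg item_messages_round[OF snd \<mu> \<mu>_def[symmetric], of \<rho>] 2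
      unfolding r X_eq round_message_def if_not_P[OF nl] by simp
    then show ?thesis using messages_within_broadcast[OF snd 2] by simp
  next
    case 3
    have F: "finite (current g)" using snd subE_finite by (auto simp: sound_def)
    obtain T where "T \<subseteq> current g" "msg = (\<lambda>i. if i < k then final_message \<mu> g T i else (\<lambda>_. {}))"
      using msg item_messages_final[OF snd \<mu> \<mu>_def[symmetric]] set_sample_edges_subset[OF F]
      unfolding r[symmetric] X_eq 3 by auto
    then show ?thesis using messages_within_final[OF snd \<mu>] by simp
  qed
qed

end

section \<open>The initial data\<close>

text \<open>Undoes \<open>concat (map sorted_list_of_set xs)\<close>: the raw input is cut into
  pieces of length \<open>d\<close>, each read as an edge.\<close>

definition blocks :: "nat \<Rightarrow> 'b list \<Rightarrow> 'b set set" where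
  "blocks d l = (\<lambda>i. set (take d (drop (d * i) l))) ` {i. d * i < length l}"

lemma blocks_append:
  assumes "length l = d" "d \<ge> 1"
  shows "blocks d (l @ l') = insert (set l) (blocks d l')"
proof -
  have "{i. d * i < length (l @ l')} = insert 0 (Suc ` {i. d * i < length l'})"
  proof (intro set_eqI iffI)
    fix i assume "i \<in> {i. d * i < length (l @ l')}"
    then show "i \<in> insert 0 (Suc ` {i. d * i < length l'})"
      using assms by (cases i) auto
  qed (use assms in auto)
  then show ?thesis using assms by (simp add: blocks_def image_image)
qed

lemma blocks_concat_sorted:
  assumes "\<And>e. e \<in> set xs \<Longrightarrow> finite e \<and> card e = d" "d \<ge> 1"
  shows "blocks d (concat (map sorted_list_of_set xs)) = set xs"
  using assms
proof (induction xs)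
  case (Cons e xs)
  then show ?case by (simp add: blocks_append)
qed (simp add: blocks_def)

lemma distinct_concat_disjoint:
  assumes "distinct (concat (map D [0..<k]))"
  shows "disjoint_family_on (\<lambda>i. set (D i)) {..<k}"
  using assms
proof (induction k)
  case (Suc k)
  have IH: "disjoint_family_on (\<lambda>i. set (D i)) {..<k}" using Suc by simp
  have new: "set (D i) \<inter> set (D k) = {}" if "i < k" for i
  proof -
    have "set (D i) \<subseteq> set (concat (map D [0..<k]))" using that by auto
    moreover have "set (concat (map D [0..<k])) \<inter> set (D k) = {}" using Suc.prems by simp
    ultimately show ?thesis by blast
  qed
  show ?case
    unfolding disjoint_family_on_def
  proof (intro ballI impI)
    fix i j assume "i \<in> {..<Suc k}" "j \<in> {..<Suc k}" "i \<noteq> j"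
    then consider "i < k" "j < k" | "i < k" "j = k" | "i = k" "j < k" by fastforce
    then show "set (D i) \<inter> set (D j) = {}"
    proof cases
      case 1
      then show ?thesis using IH \<open>i \<noteq> j\<close> by (simp add: disjoint_family_on_def)
    next
      case 2
      then show ?thesis using new by simp
    next
      case 3
      then show ?thesis using new[of j] by (simp add: Int_commute)
    qed
  qed
qed (simp add: disjoint_family_on_def)

lemma length_concat_sorted:
  assumes "\<And>e. e \<in> set xs \<Longrightarrow> card e = d"
  shows "length (concat (map sorted_list_of_set xs)) = d * length xs"
  using assms by (induction xs) auto

definition sampling_mpc_program ::
  "nat \<Rightarrow> nat \<Rightarrow> nat \<Rightarrow> nat \<Rightarrow> nat \<Rightarrow> (nat set \<Rightarrow> nat set set \<Rightarrow> nat set set) \<Rightarrow> (item \<Rightarrow> nat) \<Rightarrow> mpc_program" where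
  "sampling_mpc_program n k d s L mm enc =
     encoded_program k enc (sampling_program.universe n k d s) (\<lambda>l. Edge ` blocks d l)
       (sampling_program.act n k d s L mm)"

definition sampling_mpc_output ::
  "nat \<Rightarrow> nat \<Rightarrow> nat \<Rightarrow> nat \<Rightarrow> (nat set \<Rightarrow> nat set set \<Rightarrow> nat set set) \<Rightarrow> (item \<Rightarrow> nat)
    \<Rightarrow> mpc_data \<Rightarrow> nat set set option" where
  "sampling_mpc_output n k d s mm enc data =
     sampling_program.result n mm (\<Union>i<k. decode_items enc (sampling_program.universe n k d s) (data i))"

text \<open>Codes start at \<open>n\<close>, above all vertices, so that a raw vertex is never
  mistaken for an item. This matters at \<open>t = 0\<close>, where the output is read from the
  initial data.\<close>

lemma sampling_mpc_correct:
  fixes n k d s L W :: nat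
  assumes n: "n \<ge> 1" and k: "k \<ge> 1" "k \<le> n ^ L" and L: "L \<ge> 1" and d: "d \<ge> 1"
    and E: "uniform_hypergraph d {..<n} E"
    and mm: "\<And>V F. uniform_hypergraph d V F \<Longrightarrow> maximal_matching F (mm V F)"
    and D: "distributed_input d k s E D"
    and enc: "inj_on enc (sampling_program.universe n k d s)"
      "enc ` sampling_program.universe n k d s \<subseteq> {n..<W}"
  defines "P \<equiv> sampling_mpc_program n k d s L mm enc"
  shows "C \<in> set_pmf (mpc_run k P (initial_config k D) r) \<Longrightarrow> mpc_within k (4 * s + 6 * n) W C"
    and "map_pmf (\<lambda>C. sampling_mpc_output n k d s mm enc (C 0))
        (mpc_run k P (initial_config k D) (4 * (2 * L + 2) * t)) =
      map_pmf sampling_result (iterated_sampling d s mm {..<n} E t)"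
proof -
  have DE: "set (D i) \<subseteq> E" if "i < k" for i
    using D that by (auto simp: distributed_input_def)
  have edge: "finite e \<and> card e = d \<and> e \<subseteq> {..<n}" if "e \<in> E" for e
    using E that finite_subset[of e "{..<n}"] by (auto simp: uniform_hypergraph_def)
  have Ds: "d * length (D i) \<le> s" if "i < k" for i
    using D that by (auto simp: distributed_input_def)
  interpret sampling_simulation n k d s L mm E "\<lambda>i. set (D i)"
  proof (unfold_locales)
    show "card (set (D i)) \<le> s" if "i < k" for i
    proof -
      have "card (set (D i)) \<le> 1 * length (D i)" by (simp add: card_length)
      also have "\<dots> \<le> d * length (D i)" using d by (intro mult_right_mono) auto
      finally show ?thesis using Ds[OF that] by simp
    qed
    show "disjoint_family_on (\<lambda>i. set (D i)) {..<k}"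
      using D by (intro distinct_concat_disjoint) (simp add: distributed_input_def)
    show "(\<Union>i<k. set (D i)) = E"
      using D by (auto simp: distributed_input_def)
  qed (use n k L d E mm in auto)
  let ?init = "\<lambda>l. Edge ` blocks d l"
  let ?dec = "decode_config k enc universe ?init"
  let ?C0 = "initial_config k D"
  have P: "P = encoded_program k enc universe ?init act"
    by (simp add: P_def sampling_mpc_program_def)
  have init: "?dec 0 ?C0 = initial"
  proof
    fix j
    have "blocks d (concat (map sorted_list_of_set (D j))) = set (D j)" if "j < k"
      using DE[OF that] edge by (intro blocks_concat_sorted d) auto
    then show "?dec 0 ?C0 j = initial j"
      using DE by (auto simp: decode_config_def initial_config_def config_def store_def transit_def)
  qed
  have W: "enc x < W" if "x \<in> universe" for x using enc(2) that by auto
  \<comment> \<open>The code of any item, here \<open>Abort\<close>, lies between \<open>n\<close>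
    and \<open>W\<close>; hence raw vertices obey the bound on words.\<close>
  have inW: "n \<le> W"
    using W[OF universe_iff(5)] enc(2) universe_iff(5) by fastforce
  note within = messages_within_run[folded init]
  show "mpc_within k (4 * s + 6 * n) W C" if C: "C \<in> set_pmf (mpc_run k P ?C0 r)"
  proof (cases r)
    case 0
    then have C_eq: "C = ?C0" using C by simp
    have len: "length (?C0 j i) \<le> (if i = j then s else 0)" if "j < k" for i j
    proof -
      have "length (concat (map sorted_list_of_set (D j))) = d * length (D j)"
        using DE[OF that] edge by (intro length_concat_sorted) auto
      then show ?thesis using Ds[OF that] that by (auto simp: initial_config_def)
    qed
    have "(\<Sum>i<k. length (?C0 j i)) \<le> s" if "j < k" for j
    proof -
      have "(\<Sum>i<k. length (?C0 j i)) \<le> (\<Sum>i<k. if i = j then s else 0)"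
        using len[OF that] by (rule sum_mono)
      also have "\<dots> \<le> s" by simp
      finally show ?thesis .
    qed
    moreover have "(\<Sum>j<k. length (?C0 j i)) \<le> s" for i
    proof -
      have "(\<Sum>j<k. length (?C0 j i)) \<le> (\<Sum>j<k. if i = j then s else 0)"
        using len by (intro sum_mono) auto
      also have "\<dots> \<le> s" by simp
      finally show ?thesis .
    qed
    moreover have "x < W" if j: "j < k" and x: "x \<in> set (?C0 j i)" for x i j
    proof -
      obtain e where "e \<in> set (D j)" "x \<in> set (sorted_list_of_set e)"
        using j x by (auto simp: initial_config_def split: if_splits)
      moreover from this have "finite e" "e \<subseteq> {..<n}" using DE[OF j] edge by auto
      ultimately have "x < n" by auto
      then show ?thesis using inW by simp
    qed
    ultimately show ?thesis
      unfolding C_eq mpc_within_def by (simp add: trans_le_add1 le_trans[of _ s])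
  next
    case (Suc r')
    have C': "C \<in> set_pmf (mpc_run k (encoded_program k enc universe ?init act) ?C0 (Suc r'))"
      using C by (simp only: P Suc)
    show ?thesis
      by (rule mpc_within_encoded_program[OF finite_universe enc(1) _ _ C'])
        (rule W within; assumption)+
  qed
  show "map_pmf (\<lambda>C. sampling_mpc_output n k d s mm enc (C 0)) (mpc_run k P ?C0 (4 * (2 * L + 2) * t)) =
      map_pmf sampling_result (iterated_sampling d s mm {..<n} E t)"
  proof (cases "t = 0")
    case True
    have "decode_items enc universe (?C0 0 i) = {}" for i
    proof (rule ccontr)
      assume "decode_items enc universe (?C0 0 i) \<noteq> {}"
      then obtain x where x: "x \<in> universe" "enc x \<in> set (?C0 0 i)" by (auto simp: decode_items_def)
      then obtain e where "e \<in> set (D 0)" "enc x \<in> set (sorted_list_of_set e)"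
        by (auto simp: initial_config_def split: if_splits)
      moreover from this have "finite e" "e \<subseteq> {..<n}" using DE[of 0] k edge by auto
      ultimately have "enc x < n" by auto
      then show False using x(1) enc(2) by force
    qed
    then show ?thesis
      using True by (simp add: sampling_mpc_output_def result_def)
  next
    case False
    let ?r = "4 * (2 * L + 2) * t"
    have "sampling_mpc_output n k d s mm enc (C 0) = result (?dec ?r C 0)" for C :: mpc_config
      using False k by (simp add: sampling_mpc_output_def decode_config_def)
    then have "map_pmf (\<lambda>C. sampling_mpc_output n k d s mm enc (C 0)) (mpc_run k P ?C0 ?r) =
        map_pmf (\<lambda>X. result (X 0)) (map_pmf (?dec ?r) (mpc_run k P ?C0 ?r))"
      by (simp only: map_pmf_comp)
    also have "map_pmf (?dec ?r) (mpc_run k P ?C0 ?r) = item_run k act initial ?r"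
      unfolding P init[symmetric] by (rule mpc_run_encoded_program[OF finite_universe enc(1) W within])
    finally show ?thesis by (simp only: result_item_run)
  qed
qed

section \<open>Asymptotics\<close>

text \<open>Each contribution to the size of the universe, as well as the offset \<open>n\<close>,
  is at most \<open>n ^ (L + d + 3)\<close>; one more factor \<open>n \<ge> 4\<close> absorbs their
  number.\<close>

lemma ex_injection_universe:
  fixes n k d s L :: nat
  assumes n: "n \<ge> 4" and k: "k \<le> n ^ L" and L: "L \<ge> 1" and d: "d \<ge> 1" and s: "s \<le> n ^ 2"
  shows "\<exists>enc. inj_on enc (sampling_program.universe n k d s) \<and>
    enc ` sampling_program.universe n k d s \<subseteq> {n..<n ^ (L + d + 4)}"
proof -
  let ?U = "sampling_program.universe n k d s"
  let ?N = "n ^ (L + d + 3)"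
  have n1: "1 \<le> n" using n by simp
  have mono: "n ^ a \<le> n ^ b" if "a \<le> b" for a b using that n1 by (rule power_increasing)
  have "4 * n ^ d \<le> n ^ (d + 1)" using n by simp
  also have "\<dots> \<le> ?N" by (rule mono) simp
  finally have b1: "4 * n ^ d \<le> ?N" .
  have b2: "n \<le> ?N" using mono[of 1 "L + d + 3"] by simp
  have "k + n \<le> n ^ L + n ^ L" using k mono[of 1 L] L by simp
  also have "\<dots> = 2 * n ^ L" by simp
  also have "\<dots> \<le> n * n ^ L" using n by (intro mult_right_mono) auto
  also have "\<dots> = n ^ (L + 1)" by simp
  finally have kn: "k + n \<le> n ^ (L + 1)" .
  have "n ^ d + s + 2 \<le> n ^ (d + 1) + n ^ (d + 1) + n ^ (d + 1)"
  proof -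
    have "n ^ d \<le> n ^ (d + 1)" by (rule mono) simp
    moreover have "n ^ 2 \<le> n ^ (d + 1)" using d by (intro mono) simp
    moreover have "n \<le> n ^ (d + 1)" using mono[of 1 "d + 1"] by simp
    moreover have "2 \<le> n" using n by simp
    ultimately show ?thesis using s by linarith
  qed
  also have "\<dots> = 3 * n ^ (d + 1)" by simp
  also have "\<dots> \<le> n * n ^ (d + 1)" using n by (intro mult_right_mono) auto
  finally have "n ^ d + s + 2 \<le> n ^ (d + 2)" by simp
  then have "(k + n) * (n ^ d + s + 2) \<le> n ^ (L + 1) * n ^ (d + 2)" using kn by (intro mult_mono) auto
  also have "\<dots> = ?N" by (simp add: power_add power2_eq_square power3_eq_cube ac_simps)
  finally have b3: "(k + n) * (n ^ d + s + 2) \<le> ?N" .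
  have "card ?U + n \<le> 4 * n ^ d + 2 + (k + n) * (n ^ d + s + 2) + n"
    using sampling_program.card_universe_le[of n k d s] by simp
  also have "\<dots> \<le> ?N + ?N + ?N + ?N" using b1 b2 b3 n by linarith
  also have "\<dots> = 4 * ?N" by simp
  also have "\<dots> \<le> n * ?N" using n by (intro mult_right_mono) auto
  also have "\<dots> = n ^ (L + d + 4)" by (simp add: numeral_eq_Suc)
  finally have "card ?U \<le> card {n..<n ^ (L + d + 4)}" by simp
  then show ?thesis
    using card_le_inj[OF sampling_program.finite_universe, of "{n..<n ^ (L + d + 4)}" n k d s] by auto
qed

text \<open>A crude bound is enough, because the exponent only becomes the depth of the trees. With
  \<open>N\<close> the input size, it follows from \<open>ln N \<le> N\<close>,
  \<open>\<bar>A\<bar> \<le> n\<close> and \<open>N \<le> n ^ (d + 2)\<close>.\<close>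

lemma machines_le_power:
  fixes n k d s \<kappa> :: nat and A :: real
  assumes n: "n \<ge> 2" "n \<ge> d" "real n \<ge> \<bar>A\<bar>" and d: "d \<ge> 1" and s: "s \<ge> 1"
    and E: "uniform_hypergraph d {..<n} E"
    and k: "real k * real s \<le> A * real (input_size d n E) * ln (real (input_size d n E)) ^ \<kappa>"
  shows "k \<le> n ^ (1 + (d + 2) * (\<kappa> + 1))"
proof -
  define N where "N = input_size d n E"
  have "N \<le> n + d * n ^ d"
    using card_uniform_hypergraph_le[OF E] by (simp add: N_def input_size_def)
  also have "\<dots> \<le> n ^ (d + 1) + n ^ (d + 1)"
    using n self_le_power[of n "d + 1"] by (intro add_mono) auto
  also have "\<dots> \<le> n ^ (d + 2)"
    using n(1) by (simp add: mult_2[symmetric])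
  finally have N: "N \<le> n ^ (d + 2)" .
  have "1 \<le> N" using n(1) by (simp add: N_def input_size_def)
  then have lnN: "0 \<le> ln (real N)" "ln (real N) \<le> real N" using ln_le_minus_one[of "real N"] by auto
  have "real k * 1 \<le> real k * real s" using s by (intro mult_left_mono) auto
  also have "\<dots> \<le> A * real N * ln (real N) ^ \<kappa>" using k by (simp add: N_def)
  also have "\<dots> \<le> real n * real N * real N ^ \<kappa>"
    using n(3) lnN by (intro mult_mono power_mono) (auto intro: mult_nonneg_nonneg)
  also have "\<dots> = real (n * N ^ (\<kappa> + 1))" by simp
  finally have "k \<le> n * N ^ (\<kappa> + 1)" by linarith
  also have "\<dots> \<le> n * (n ^ (d + 2)) ^ (\<kappa> + 1)" using N by (intro mult_left_mono power_mono) auto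
  also have "\<dots> = n ^ (1 + (d + 2) * (\<kappa> + 1))" by (simp only: power_mult power_add power_one_right)
  finally show ?thesis .
qed

text \<open>Solves \<open>\<gamma> ^ t * n ^ d \<le> 1\<close> for \<open>t\<close>, where \<gamma>
  is the shrinking factor; the added 1 guarantees at least one pass.\<close>

definition iteration_bound :: "nat \<Rightarrow> real \<Rightarrow> nat \<Rightarrow> nat" where
  "iteration_bound d c n = nat \<lceil>d * ln n / - ln (1 - exp (- (2 + 4 / c)))\<rceil> + 1"

lemma shrinking_factor:
  fixes c :: real
  assumes "c > 0"
  shows "0 < 1 - exp (- (2 + 4 / c))" "1 - exp (- (2 + 4 / c)) < 1"
proof -
  have "0 < 2 + 4 / c" using assms by (intro add_pos_pos) auto
  then have "exp (- (2 + 4 / c)) < 1" by (simp only: exp_less_one_iff neg_less_0_iff_less)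
  then show "0 < 1 - exp (- (2 + 4 / c))" "1 - exp (- (2 + 4 / c)) < 1" by simp_all
qed

lemma iteration_bound_sufficient:
  fixes c :: real
  assumes c: "c > 0" and n: "n \<ge> 1"
  shows "(1 - exp (- (2 + 4 / c))) ^ iteration_bound d c n * real (n ^ d) \<le> 1"
proof -
  define \<gamma> where "\<gamma> = 1 - exp (- (2 + 4 / c))"
  have \<gamma>: "0 < \<gamma>" "\<gamma> < 1" using shrinking_factor[OF c] by (auto simp: \<gamma>_def)
  define t where "t = iteration_bound d c n"
  have "d * ln n / - ln \<gamma> \<le> real t" unfolding t_def iteration_bound_def \<gamma>_def[symmetric] by linarith
  moreover have "0 < - ln \<gamma>" using \<gamma> by simp
  ultimately have "d * ln n \<le> real t * (- ln \<gamma>)" by (simp only: pos_divide_le_eq)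
  then have "real t * ln \<gamma> + d * ln n \<le> 0" by simp
  then have "exp (real t * ln \<gamma>) * exp (d * ln n) \<le> 1" by (simp flip: exp_add)
  then show ?thesis
    unfolding \<gamma>_def[symmetric] t_def[symmetric] using \<gamma> n by (simp add: exp_of_nat_mult)
qed

lemma iteration_bound_le:
  fixes c :: real
  assumes c: "c > 0" and n: "n \<ge> 1"
  shows "real (iteration_bound d c n) \<le> d * ln n / - ln (1 - exp (- (2 + 4 / c))) + 2"
proof -
  have "ln (1 - exp (- (2 + 4 / c))) < 0" using shrinking_factor[OF c] by simp
  then have "0 \<le> d * ln n / - ln (1 - exp (- (2 + 4 / c)))"
    using n by (intro divide_nonneg_pos mult_nonneg_nonneg) auto
  then show ?thesis unfolding iteration_bound_def by linarith
qed

lemma iteration_bound_bigo: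
  fixes c :: real
  assumes c: "c > 0"
  shows "(\<lambda>n. real (q * iteration_bound d c n)) \<in> O(\<lambda>n. ln (real n))"
proof -
  define l where "l = - ln (1 - exp (- (2 + 4 / c)))"
  have l: "l > 0" using shrinking_factor[OF c] by (simp add: l_def)
  have "(\<lambda>n. real (q * iteration_bound d c n)) \<in> O(\<lambda>n. q * (d * ln (real n) / l + 2))"
  proof (rule landau_o.big_mono, rule eventually_mono[OF eventually_ge_at_top[of 1]])
    fix n :: nat assume n: "1 \<le> n"
    have "real (q * iteration_bound d c n) \<le> q * (d * ln (real n) / l + 2)"
      using iteration_bound_le[OF c n, of d] by (simp add: l_def mult_left_mono)
    then show "norm (real (q * iteration_bound d c n)) \<le> norm (q * (d * ln (real n) / l + 2))" by simp
  qed
  also have "(\<lambda>n. q * (d * ln (real n) / l + 2)) \<in> O(\<lambda>n. ln (real n))"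
  proof -
    have "(\<lambda>n. 2 * real q) \<in> O(\<lambda>n. ln (real n))" by real_asymp
    moreover have "(\<lambda>n. (q * d / l) * ln (real n)) \<in> O(\<lambda>n. ln (real n))"
      by (rule bigoI[of _ "norm (q * d / l)"]) (simp only: norm_mult order_refl eventually_True)
    ultimately have "(\<lambda>n. (q * d / l) * ln (real n) + 2 * real q) \<in> O(\<lambda>n. ln (real n))"
      by (intro sum_in_bigo)
    then show ?thesis by (simp add: algebra_simps)
  qed
  finally show ?thesis .
qed

text \<open>Logarithmically many passes, each failing with exponentially small probability.\<close>

lemma failure_bound_tendsto:
  fixes c :: real
  assumes c: "c > 0"
  shows "(\<lambda>n. real (iteration_bound d c n) * (2 * exp (- c * real n / 8) + exp (- real n))) \<longlonglongrightarrow> 0"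
proof -
  define l where "l = - ln (1 - exp (- (2 + 4 / c)))"
  have l: "l > 0" using shrinking_factor[OF c] by (simp add: l_def)
  have "(\<lambda>n. ln (real n) * exp (- (c * real n / 8))) \<longlonglongrightarrow> 0"
    "(\<lambda>n. exp (- (c * real n / 8))) \<longlonglongrightarrow> 0"
    using c by (real_asymp, real_asymp)
  moreover have "(\<lambda>n. ln (real n) * exp (- real n)) \<longlonglongrightarrow> 0" "(\<lambda>n. exp (- real n)) \<longlonglongrightarrow> 0"
    by real_asymp+
  ultimately have "(\<lambda>n. d / l * (2 * (ln (real n) * exp (- (c * real n / 8))) + ln (real n) * exp (- real n)) +
      2 * (2 * exp (- (c * real n / 8)) + exp (- real n))) \<longlonglongrightarrow> d / l * (2 * 0 + 0) + 2 * (2 * 0 + 0)"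
    by (intro tendsto_intros)
  then have "(\<lambda>n. (d * ln (real n) / l + 2) * (2 * exp (- c * real n / 8) + exp (- real n))) \<longlonglongrightarrow> 0"
    by (simp add: algebra_simps)
  then show ?thesis
  proof (rule tendsto_sandwich[OF _ _ tendsto_const, rotated 2])
    show "\<forall>\<^sub>F n in sequentially. real (iteration_bound d c n) * (2 * exp (- c * real n / 8) + exp (- real n))
        \<le> (d * ln (real n) / l + 2) * (2 * exp (- c * real n / 8) + exp (- real n))"
    proof (rule eventually_mono[OF eventually_ge_at_top[of 1]])
      fix n :: nat assume "1 \<le> n"
      then have "real (iteration_bound d c n) \<le> d * ln (real n) / l + 2"
        using iteration_bound_le[OF c] by (simp add: l_def)
      then show "real (iteration_bound d c n) * (2 * exp (- c * real n / 8) + exp (- real n))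
        \<le> (d * ln (real n) / l + 2) * (2 * exp (- c * real n / 8) + exp (- real n))"
        by (intro mult_right_mono add_nonneg_nonneg) auto
    qed
  qed simp
qed

text \<open>The program depends on \<open>n\<close> and \<open>k\<close> but not on the hypergraph
  or its distribution. The memory \<open>S\<close> exceeds the parameter \<open>s\<close> by a
  constant factor for large \<open>n\<close>, since a machine keeps several kinds of items and all
  are charged as messages. The equality of laws after \<open>q * t\<close> rounds ensures that the
  program really runs the algorithm, not merely some other way to a maximal matching. Words below
  \<open>n ^ w\<close> have O(log n) bits.\<close>

theorem theorem5p1:
  fixes d \<kappa> :: nat and A :: real
    and s :: "nat \<Rightarrow> nat"
    and mm :: "nat set \<Rightarrow> nat set set \<Rightarrow> nat set set"
  assumes d: "d \<ge> 1"
    and s: "(\<lambda>n. real (s n)) \<in> \<Theta>(\<lambda>n. real d * real n)"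
    and mm: "\<And>V F. uniform_hypergraph d V F \<Longrightarrow> maximal_matching F (mm V F)"
  shows "\<exists>(P :: nat \<Rightarrow> nat \<Rightarrow> mpc_program)
           (out :: nat \<Rightarrow> nat \<Rightarrow> mpc_data \<Rightarrow> nat set set option)
           (S :: nat \<Rightarrow> nat) (R :: nat \<Rightarrow> nat) (\<epsilon> :: nat \<Rightarrow> real) (q :: nat) (w :: nat) (n0 :: nat).
     (\<lambda>n. real (S n)) \<in> \<Theta>(\<lambda>n. real d * real n) \<and>
     (\<lambda>n. real (R n)) \<in> O(\<lambda>n. ln (real n)) \<and>
     \<epsilon> \<longlonglongrightarrow> 0 \<and>
     (\<forall>n\<ge>n0. \<forall>E k D.
        uniform_hypergraph d {..<n} E \<and>
        k \<ge> 1 \<and>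
        real k * real (s n) \<le> A * real (input_size d n E) * ln (real (input_size d n E)) ^ \<kappa> \<and>
        distributed_input d k (s n) E D
        \<longrightarrow>
        (\<forall>r. \<forall>C\<in>set_pmf (mpc_run k (P n k) (initial_config k D) r). mpc_within k (S n) (n ^ w) C) \<and>
        (\<forall>t. map_pmf (\<lambda>C. out n k (C 0)) (mpc_run k (P n k) (initial_config k D) (q * t))
             = map_pmf sampling_result (iterated_sampling d (s n) mm {..<n} E t)) \<and>
        measure_pmf.prob (mpc_run k (P n k) (initial_config k D) (R n))
          {C. \<exists>M. out n k (C 0) = Some M \<and> maximal_matching E M} \<ge> 1 - \<epsilon> n)"
proof -
  obtain c1 where c1: "c1 > 0"
      "\<forall>\<^sub>F n in sequentially. c1 * norm (real d * real n) \<le> norm (real (s n))"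
    using landau_omega.bigE[of "\<lambda>n. real (s n)" sequentially "\<lambda>n. real d * real n"] s
    by (auto simp: bigtheta_def)
  obtain c2 where c2: "c2 > 0"
      "\<forall>\<^sub>F n in sequentially. norm (real (s n)) \<le> c2 * norm (real d * real n)"
    using landau_o.bigE[of "\<lambda>n. real (s n)" sequentially "\<lambda>n. real d * real n"] s
    by (auto simp: bigtheta_def)
  \<comment> \<open>Chosen so that \<open>c1 * d * n \<le> s n\<close> becomes
    \<open>c * n \<le> s n / (5 * d)\<close>.\<close>
  define c where "c = c1 / 5"
  have c: "c > 0" using c1(1) by (simp add: c_def)
  define L where "L = 1 + (d + 2) * (\<kappa> + 1)"
  define w where "w = L + d + 4"
  define q where "q = 4 * (2 * L + 2)"
  define S where "S = (\<lambda>n. 4 * s n + 6 * n)"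
  define T where "T = iteration_bound d c"
  define \<epsilon> where "\<epsilon> = (\<lambda>n. real (T n) * (2 * exp (- c * real n / 8) + exp (- real n)))"
  \<comment> \<open>The encoding is selected from \<open>n\<close> and \<open>k\<close> alone,
    because the program may depend on nothing else.\<close>
  define enc where "enc = (\<lambda>n k. SOME enc. inj_on enc (sampling_program.universe n k d (s n)) \<and>
      enc ` sampling_program.universe n k d (s n) \<subseteq> {n..<n ^ w})"
  define P where "P = (\<lambda>n k. sampling_mpc_program n k d (s n) L mm (enc n k))"
  define out where "out = (\<lambda>n k. sampling_mpc_output n k d (s n) mm (enc n k))"
  have "\<forall>\<^sub>F n in sequentially. real n \<ge> max \<bar>A\<bar> (max (c2 * real d) (1 / (c1 * real d)))"
    by real_asymp
  then have "\<forall>\<^sub>F n in sequentially. n \<ge> 4 \<and> n \<ge> d \<and> real n \<ge> \<bar>A\<bar> \<and> real n \<ge> c2 * real d \<and>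
      real n \<ge> 1 / (c1 * real d) \<and> c1 * norm (real d * real n) \<le> norm (real (s n)) \<and>
      norm (real (s n)) \<le> c2 * norm (real d * real n)"
    using c1(2) c2(2) eventually_ge_at_top[of 4] eventually_ge_at_top[of d] by eventually_elim auto
  \<comment> \<open>Here \<open>n \<ge> c2 * d\<close> will give \<open>s n \<le> n ^ 2\<close>,
    \<open>n \<ge> 1 / (c1 * d)\<close> will give \<open>s n \<ge> 1\<close>, and
    \<open>n \<ge> \<bar>A\<bar>\<close> serves the bound on the number of machines.\<close>
  then obtain n0 where n0: "\<And>n. n \<ge> n0 \<Longrightarrow> n \<ge> 4 \<and> n \<ge> d \<and> real n \<ge> \<bar>A\<bar> \<and> real n \<ge> c2 * real d \<and>
      real n \<ge> 1 / (c1 * real d) \<and> c1 * norm (real d * real n) \<le> norm (real (s n)) \<and>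
      norm (real (s n)) \<le> c2 * norm (real d * real n)"
    unfolding eventually_sequentially by blast
  have S: "(\<lambda>n. real (S n)) \<in> \<Theta>(\<lambda>n. real d * real n)"
  proof (rule bigthetaI'[of "4 * c1" "4 * c2 + 6"])
    show "\<forall>\<^sub>F n in sequentially. 4 * c1 * norm (real d * real n) \<le> norm (real (S n)) \<and>
        norm (real (S n)) \<le> (4 * c2 + 6) * norm (real d * real n)"
      using c1(2) c2(2)
    proof eventually_elim
      case (elim n)
      have "real n \<le> real d * real n" using d by (simp add: mult_le_cancel_right1)
      then show ?case using elim by (auto simp: S_def algebra_simps)
    qed
  qed (use c1 c2 in auto)
  have correct:
    "(\<forall>r. \<forall>C\<in>set_pmf (mpc_run k (P n k) (initial_config k D) r). mpc_within k (S n) (n ^ w) C) \<and>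
     (\<forall>t. map_pmf (\<lambda>C. out n k (C 0)) (mpc_run k (P n k) (initial_config k D) (q * t))
        = map_pmf sampling_result (iterated_sampling d (s n) mm {..<n} E t)) \<and>
     measure_pmf.prob (mpc_run k (P n k) (initial_config k D) (q * T n))
        {C. \<exists>M. out n k (C 0) = Some M \<and> maximal_matching E M} \<ge> 1 - \<epsilon> n"
    if n: "n \<ge> n0" and E: "uniform_hypergraph d {..<n} E" and k: "k \<ge> 1"
      and kA: "real k * real (s n) \<le> A * real (input_size d n E) * ln (real (input_size d n E)) ^ \<kappa>"
      and D: "distributed_input d k (s n) E D" for n E k D
  proof -
    have n4: "n \<ge> 4" and nd: "n \<ge> d" and nA: "real n \<ge> \<bar>A\<bar>" and nc2: "c2 * real d \<le> real n"
      and nc1: "1 / (c1 * real d) \<le> real n"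
      and s1: "c1 * (real d * real n) \<le> real (s n)" and s2: "real (s n) \<le> c2 * (real d * real n)"
      using n0[OF n] by auto
    have n1: "n \<ge> 1" using n4 by simp
    have "1 \<le> c1 * (real d * real n)" using nc1 c1(1) d by (simp add: field_simps)
    then have s_pos: "s n \<ge> 1" using s1 by linarith
    have "real (s n) \<le> real n * real n"
      using s2 mult_right_mono[OF nc2, of "real n"] by (simp add: mult.assoc)
    then have "s n \<le> n * n" by (simp flip: of_nat_mult)
    then have s_sq: "s n \<le> n ^ 2" by (simp add: power2_eq_square)
    have kL: "k \<le> n ^ L"
      unfolding L_def using n4 by (intro machines_le_power[OF _ nd nA d s_pos E kA]) simp
    have L1: "L \<ge> 1" by (simp add: L_def)
    have "\<exists>enc. inj_on enc (sampling_program.universe n k d (s n)) \<and>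
        enc ` sampling_program.universe n k d (s n) \<subseteq> {n..<n ^ w}"
      unfolding w_def by (rule ex_injection_universe[OF n4 kL L1 d s_sq])
    then have enc: "inj_on (enc n k) (sampling_program.universe n k d (s n))"
      "enc n k ` sampling_program.universe n k d (s n) \<subseteq> {n..<n ^ w}"
      unfolding enc_def by (metis (mono_tags, lifting) someI_ex)+
    have within: "mpc_within k (S n) (n ^ w) C"
      if "C \<in> set_pmf (mpc_run k (P n k) (initial_config k D) r)" for C r
      unfolding S_def by (rule sampling_mpc_correct(1)[where mm = mm, OF n1 k kL L1 d E mm D enc])
        (use that in \<open>auto simp: P_def\<close>)
    have same: "map_pmf (\<lambda>C. out n k (C 0)) (mpc_run k (P n k) (initial_config k D) (q * t))
        = map_pmf sampling_result (iterated_sampling d (s n) mm {..<n} E t)" for t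
      using sampling_mpc_correct(2)[where mm = mm, OF n1 k kL L1 d E mm D enc, of t]
      by (simp only: P_def out_def q_def)
    have "1 - \<epsilon> n \<le> measure_pmf.prob (map_pmf sampling_result (iterated_sampling d (s n) mm {..<n} E (T n)))
        {r. \<exists>M. r = Some M \<and> maximal_matching E M}"
    proof -
      have "c * real (card {..<n}) \<le> real (s n) / (5 * real d)"
        using s1 d by (simp add: c_def field_simps)
      moreover have "(1 - exp (- (2 + 4 / c))) ^ T n * real (card {..<n} ^ d) \<le> 1"
        using iteration_bound_sufficient[OF c n1, of d] by (simp add: T_def)
      moreover have "T n \<ge> 1" by (simp add: T_def iteration_bound_def)
      ultimately show ?thesis
        using prob_iterated_sampling_maximal[where mm = mm and t = "T n", OF E d c _ s_pos mm]
        by (simp add: \<epsilon>_def)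
    qed
    also have "\<dots> = measure_pmf.prob (mpc_run k (P n k) (initial_config k D) (q * T n))
        {C. \<exists>M. out n k (C 0) = Some M \<and> maximal_matching E M}"
      unfolding same[symmetric] by (simp add: vimage_def)
    finally show ?thesis using within same by blast
  qed
  show ?thesis
  proof (intro exI conjI)
    show "(\<lambda>n. real (S n)) \<in> \<Theta>(\<lambda>n. real d * real n)" by (rule S)
    show "(\<lambda>n. real (q * T n)) \<in> O(\<lambda>n. ln (real n))"
      unfolding T_def by (rule iteration_bound_bigo[OF c])
    show "\<epsilon> \<longlonglongrightarrow> 0"
      unfolding \<epsilon>_def T_def by (rule failure_bound_tendsto[OF c])
    show "\<forall>n\<ge>n0. \<forall>E k D.
        uniform_hypergraph d {..<n} E \<and>
        k \<ge> 1 \<and>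
        real k * real (s n) \<le> A * real (input_size d n E) * ln (real (input_size d n E)) ^ \<kappa> \<and>
        distributed_input d k (s n) E D
        \<longrightarrow>
        (\<forall>r. \<forall>C\<in>set_pmf (mpc_run k (P n k) (initial_config k D) r). mpc_within k (S n) (n ^ w) C) \<and>
        (\<forall>t. map_pmf (\<lambda>C. out n k (C 0)) (mpc_run k (P n k) (initial_config k D) (q * t))
             = map_pmf sampling_result (iterated_sampling d (s n) mm {..<n} E t)) \<and>
        measure_pmf.prob (mpc_run k (P n k) (initial_config k D) (q * T n))
          {C. \<exists>M. out n k (C 0) = Some M \<and> maximal_matching E M} \<ge> 1 - \<epsilon> n"
      by (intro allI impI, elim conjE, rule correct)
  qed
qed

end
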